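(* If $\mathcal{G}$ is a model of $\phi_{\mathcal{F}}$, then $(V(\mathcal{G}),\triangleleft)$ is a linear order with character $\chi(V(\mathcal{G}),\triangleleft)=cf(M(\mathcal{G}),<)$.
   Context: Fix a countable structure $\mathcal{M}$ in a countable language $\mathcal{L}_0$ containing a binary relation symbol $<$ interpreted as a linear order on $\mathcal{M}$, whose Scott sentence $\phi$ has a model of cardinality $\aleph_1$ but none of cardinality $\aleph_2$. Let $\mathcal{L}$ extend $\mathcal{L}_0$ by unary predicates $V,M,N$, a binary relation $\triangleleft$ and a binary function symbol $f$. $K(\mathcal{M})$ is the class of countable $\mathcal{L}$-structures $\mathcal{A}$ such that: (1) $V(\mathcal{A}),M(\mathcal{A})$ partition the universe, $V(\mathcal{A})$ is finite and $M(\mathcal{A})$ (with its $\mathcal{L}_0$-structure) is $\mathcal{M}$; (2) $\triangleleft$ is a linear order on $V(\mathcal{A})$; (3) for $x\ne y$ in $V(\mathcal{A})$, $f(x,y)=f(y,x)\in M(\mathcal{A})$; (4) if $x\triangleleft y\triangleleft z$ are distinct elements of $V(\mathcal{A})$, then either $f(x,y)=f(x,z)=f(y,z)$, or $f(x,y)=f(x,z)<f(y,z)$, or $f(x,z)=f(y,z)<f(x,y)$; (5) $N(x)$ implies $x\in V(\mathcal{A})$. A finitely generated$/\mathcal{M}$ substructure of a structure containing $\mathcal{M}$ is one of the form $\langle A_0\rangle\cup\mathcal{M}$, $A_0$ finite. $\mathcal{F}$ is the Fraïssé limit of $K(\mathcal{M})$: the (unique up to isomorphism) countable $\mathcal{L}$-structure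 containing $\mathcal{M}$ whose finitely generated$/\mathcal{M}$ substructures are, up to isomorphism, exactly the members of $K(\mathcal{M})$ and in which every isomorphism between finitely generated$/\mathcal{M}$ substructures extends to an automorphism; $\phi_{\mathcal{F}}$ is its Scott sentence. For a linear order $(L,<)$ and $m\in L$, the left character of $m$ is the least cardinal $\kappa$ admitting a cofinal map from $\kappa$ into $\{n:n<m\}$, the right character the least $\kappa$ admitting a coinitial map from $\kappa$ into $\{n:n>m\}$; $\chi(m)$ is the smaller of the two, and $\chi(L,<)=\min\{\chi(m):m\in L\}$.
   Formalization: Adds that (M,<) has no greatest element (otherwise cf(M,<)=1 while χ(V(F))=ω), and fixes f, ◁ and the L_0-symbols trivially outside their intended domains (relations false, functions return the first argument), as otherwise K(M) lacks joint embedding. *)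

theory Defs
  imports Main "HOL-Library.Countable_Set"
begin

unbundle cardinal_syntax

record ('f, 'r) lang =
  funs :: "'f set"
  rels :: "'r set"
  fun_ar :: "'f \<Rightarrow> nat"
  rel_ar :: "'r \<Rightarrow> nat"

text \<open>Only the values on tuples of the right length from the universe are meaningful.\<close>

record ('f, 'r, 'a) struct =
  univ :: "'a set"
  fint :: "'f \<Rightarrow> 'a list \<Rightarrow> 'a"
  rint :: "'r \<Rightarrow> 'a list \<Rightarrow> bool"

definition countable_lang :: "('f, 'r) lang \<Rightarrow> bool" where
  "countable_lang L \<longleftrightarrow> countable (funs L) \<and> countable (rels L)"

definition tuples :: "'a set \<Rightarrow> nat \<Rightarrow> 'a list set" where
  "tuples X n = {xs. set xs \<subseteq> X \<and> length xs = n}"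

definition closed_under :: "('f, 'r) lang \<Rightarrow> ('f, 'r, 'a) struct \<Rightarrow> 'a set \<Rightarrow> bool" where
  "closed_under L A X \<longleftrightarrow> (\<forall>s\<in>funs L. \<forall>xs\<in>tuples X (fun_ar L s). fint A s xs \<in> X)"

definition is_struct :: "('f, 'r) lang \<Rightarrow> ('f, 'r, 'a) struct \<Rightarrow> bool" where
  "is_struct L A \<longleftrightarrow> univ A \<noteq> {} \<and> closed_under L A (univ A)"

definition is_iso ::
  "('f, 'r) lang \<Rightarrow> ('f, 'r, 'a) struct \<Rightarrow> ('f, 'r, 'b) struct \<Rightarrow> ('a \<Rightarrow> 'b) \<Rightarrow> bool" where
  "is_iso L A B h \<longleftrightarrow>
     bij_betw h (univ A) (univ B) \<and>
     (\<forall>s\<in>funs L. \<forall>xs\<in>tuples (univ A) (fun_ar L s). h (fint A s xs) = fint B s (map h xs)) \<and>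
     (\<forall>R\<in>rels L. \<forall>xs\<in>tuples (univ A) (rel_ar L R). rint A R xs \<longleftrightarrow> rint B R (map h xs))"

definition isomorphic ::
  "('f, 'r) lang \<Rightarrow> ('f, 'r, 'a) struct \<Rightarrow> ('f, 'r, 'b) struct \<Rightarrow> bool" where
  "isomorphic L A B \<longleftrightarrow> (\<exists>h. is_iso L A B h)"

definition restr :: "('f, 'r, 'a) struct \<Rightarrow> 'a set \<Rightarrow> ('f, 'r, 'a) struct" where
  "restr A X = A\<lparr>univ := X\<rparr>"

definition generated :: "('f, 'r) lang \<Rightarrow> ('f, 'r, 'a) struct \<Rightarrow> 'a set \<Rightarrow> 'a set" where
  "generated L A A0 = \<Inter>{X. A0 \<subseteq> X \<and> X \<subseteq> univ A \<and> closed_under L A X}"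

definition rel_on :: "('f, 'r, 'a) struct \<Rightarrow> 'r \<Rightarrow> 'a set \<Rightarrow> 'a rel" where
  "rel_on A R X = {(x, y). x \<in> X \<and> y \<in> X \<and> rint A R [x, y]}"

text \<open>
  The logic $L_{\omega_1,\omega}$.  A subformula of a sentence automatically has only finitely many
  free variables, since only finitely many quantifiers stand above it.
\<close>

datatype 'f tm = Var nat | App 'f "'f tm list"

datatype ('f, 'r) fm =
    FEq "'f tm" "'f tm"
  | FRel 'r "'f tm list"
  | FNot "('f, 'r) fm"
  | FConj "nat \<Rightarrow> ('f, 'r) fm"
  | FEx nat "('f, 'r) fm"

primrec tm_vars :: "'f tm \<Rightarrow> nat set" where
  "tm_vars (Var i) = {i}"
| "tm_vars (App s ts) = \<Union>(set (map tm_vars ts))"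

primrec tm_wf :: "('f, 'r) lang \<Rightarrow> 'f tm \<Rightarrow> bool" where
  "tm_wf L (Var i) \<longleftrightarrow> True"
| "tm_wf L (App s ts) \<longleftrightarrow>
     s \<in> funs L \<and> length ts = fun_ar L s \<and> (\<forall>b\<in>set (map (tm_wf L) ts). b)"

primrec tm_val :: "('f, 'r, 'a) struct \<Rightarrow> (nat \<Rightarrow> 'a) \<Rightarrow> 'f tm \<Rightarrow> 'a" where
  "tm_val A e (Var i) = e i"
| "tm_val A e (App s ts) = fint A s (map (tm_val A e) ts)"

primrec free_vars :: "('f, 'r) fm \<Rightarrow> nat set" where
  "free_vars (FEq t u) = tm_vars t \<union> tm_vars u"
| "free_vars (FRel R ts) = (\<Union>t\<in>set ts. tm_vars t)"
| "free_vars (FNot p) = free_vars p"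
| "free_vars (FConj ps) = (\<Union>n. free_vars (ps n))"
| "free_vars (FEx i p) = free_vars p - {i}"

primrec fm_wf :: "('f, 'r) lang \<Rightarrow> ('f, 'r) fm \<Rightarrow> bool" where
  "fm_wf L (FEq t u) \<longleftrightarrow> tm_wf L t \<and> tm_wf L u"
| "fm_wf L (FRel R ts) \<longleftrightarrow> R \<in> rels L \<and> length ts = rel_ar L R \<and> (\<forall>t\<in>set ts. tm_wf L t)"
| "fm_wf L (FNot p) \<longleftrightarrow> fm_wf L p"
| "fm_wf L (FConj ps) \<longleftrightarrow> (\<forall>n. fm_wf L (ps n))"
| "fm_wf L (FEx i p) \<longleftrightarrow> fm_wf L p"

primrec sat :: "('f, 'r, 'a) struct \<Rightarrow> (nat \<Rightarrow> 'a) \<Rightarrow> ('f, 'r) fm \<Rightarrow> bool" where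
  "sat A e (FEq t u) \<longleftrightarrow> tm_val A e t = tm_val A e u"
| "sat A e (FRel R ts) \<longleftrightarrow> rint A R (map (tm_val A e) ts)"
| "sat A e (FNot p) \<longleftrightarrow> \<not> sat A e p"
| "sat A e (FConj ps) \<longleftrightarrow> (\<forall>n. sat A e (ps n))"
| "sat A e (FEx i p) \<longleftrightarrow> (\<exists>a\<in>univ A. sat A (e(i := a)) p)"

definition sentence :: "('f, 'r) lang \<Rightarrow> ('f, 'r) fm \<Rightarrow> bool" where
  "sentence L p \<longleftrightarrow> fm_wf L p \<and> free_vars p = {}"

definition model_of :: "('f, 'r) lang \<Rightarrow> ('f, 'r) fm \<Rightarrow> ('f, 'r, 'a) struct \<Rightarrow> bool" where
  "model_of L p A \<longleftrightarrow> is_struct L A \<and> (\<forall>e. range e \<subseteq> univ A \<longrightarrow> sat A e p)"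

text \<open>
  A Scott sentence of \<open>A\<close> is true in \<open>A\<close> and has no other countable models up to isomorphism.
  Every countable structure has an isomorphic copy whose universe is a set of natural numbers.
\<close>

definition scott_sentence :: "('f, 'r) lang \<Rightarrow> ('f, 'r, 'a) struct \<Rightarrow> ('f, 'r) fm \<Rightarrow> bool" where
  "scott_sentence L A p \<longleftrightarrow>
     sentence L p \<and> model_of L p A \<and>
     (\<forall>B :: ('f, 'r, nat) struct. model_of L p B \<longrightarrow> isomorphic L A B)"

abbreviation aleph1 :: "nat set rel" where
  "aleph1 \<equiv> cardSuc natLeq"

abbreviation aleph2 :: "nat set set rel" where
  "aleph2 \<equiv> cardSuc aleph1"

text \<open>
  The type of sets of sets of naturals has at least \<open>aleph2\<close> elements, so every structure of
  cardinality at most \<open>aleph2\<close> has an isomorphic copy with universe in this type.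
\<close>

definition has_model_of_card :: "('f, 'r) lang \<Rightarrow> ('f, 'r) fm \<Rightarrow> 'c rel \<Rightarrow> bool" where
  "has_model_of_card L p \<kappa> \<longleftrightarrow>
     (\<exists>A :: ('f, 'r, nat set set) struct. model_of L p A \<and> card_of (univ A) =o \<kappa>)"

datatype 'f xfun = OldF 'f | F_sym

datatype 'r xrel = OldR 'r | V_sym | M_sym | N_sym | Tri_sym

definition xlang :: "('f, 'r) lang \<Rightarrow> ('f xfun, 'r xrel) lang" where
  "xlang L0 = \<lparr>
     funs = OldF ` funs L0 \<union> {F_sym},
     rels = OldR ` rels L0 \<union> {V_sym, M_sym, N_sym, Tri_sym},
     fun_ar = case_xfun (fun_ar L0) 2,
     rel_ar = case_xrel (rel_ar L0) 1 1 1 2\<rparr>"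

type_synonym ('f, 'r, 'a) xstruct = "('f xfun, 'r xrel, 'a) struct"

definition Vpart :: "('f, 'r, 'a) xstruct \<Rightarrow> 'a set" where
  "Vpart A = {x \<in> univ A. rint A V_sym [x]}"

definition Mpart :: "('f, 'r, 'a) xstruct \<Rightarrow> 'a set" where
  "Mpart A = {x \<in> univ A. rint A M_sym [x]}"

definition Npart :: "('f, 'r, 'a) xstruct \<Rightarrow> 'a set" where
  "Npart A = {x \<in> univ A. rint A N_sym [x]}"

definition Mstruct :: "('f, 'r, 'a) xstruct \<Rightarrow> ('f, 'r, 'a) struct" where
  "Mstruct A = \<lparr>univ = Mpart A, fint = \<lambda>s. fint A (OldF s), rint = \<lambda>R. rint A (OldR R)\<rparr>"

abbreviation ff :: "('f, 'r, 'a) xstruct \<Rightarrow> 'a \<Rightarrow> 'a \<Rightarrow> 'a" where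
  "ff A x y \<equiv> fint A F_sym [x, y]"

abbreviation tri :: "('f, 'r, 'a) xstruct \<Rightarrow> 'a rel" where
  "tri A \<equiv> rel_on A Tri_sym (Vpart A)"

abbreviation less_M :: "'r \<Rightarrow> ('f, 'r, 'a) xstruct \<Rightarrow> 'a rel" where
  "less_M lt A \<equiv> rel_on A (OldR lt) (Mpart A)"

text \<open>
  Symbols are interpreted trivially outside their intended domain: the old symbols live on the
  \<open>M\<close>-part, the binary relation on the \<open>V\<close>-part, the binary function on pairs of distinct elements of
  the \<open>V\<close>-part.  Relations are false and functions return their first argument elsewhere.  Without
  such a convention the class below would not have the joint embedding property.
\<close>

definition trivial_off_domain :: "('f, 'r) lang \<Rightarrow> ('f, 'r, 'a) xstruct \<Rightarrow> bool" where
  "trivial_off_domain L0 A \<longleftrightarrow>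
     (\<forall>R\<in>rels L0. \<forall>xs\<in>tuples (univ A) (rel_ar L0 R).
        rint A (OldR R) xs \<longrightarrow> set xs \<subseteq> Mpart A) \<and>
     (\<forall>s\<in>funs L0. \<forall>xs\<in>tuples (univ A) (fun_ar L0 s).
        \<not> set xs \<subseteq> Mpart A \<longrightarrow> fint A (OldF s) xs = hd xs) \<and>
     (\<forall>x\<in>univ A. \<forall>y\<in>univ A. rint A Tri_sym [x, y] \<longrightarrow> x \<in> Vpart A \<and> y \<in> Vpart A) \<and>
     (\<forall>x\<in>univ A. \<forall>y\<in>univ A. \<not> (x \<in> Vpart A \<and> y \<in> Vpart A \<and> x \<noteq> y) \<longrightarrow> ff A x y = x)"

definition in_K ::
  "('f, 'r) lang \<Rightarrow> 'r \<Rightarrow> ('f, 'r, 'm) struct \<Rightarrow> ('f, 'r, 'a) xstruct \<Rightarrow> bool" where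
  "in_K L0 lt M A \<longleftrightarrow>
     is_struct (xlang L0) A \<and> countable (univ A) \<and> trivial_off_domain L0 A \<and>
     Vpart A \<union> Mpart A = univ A \<and> Vpart A \<inter> Mpart A = {} \<and> finite (Vpart A) \<and>
     is_struct L0 (Mstruct A) \<and> isomorphic L0 (Mstruct A) M \<and>
     strict_linear_order_on (Vpart A) (tri A) \<and>
     (\<forall>x\<in>Vpart A. \<forall>y\<in>Vpart A. x \<noteq> y \<longrightarrow> ff A x y = ff A y x \<and> ff A x y \<in> Mpart A) \<and>
     (\<forall>x y z. (x, y) \<in> tri A \<and> (y, z) \<in> tri A \<longrightarrow>
        (ff A x y = ff A x z \<and> ff A x z = ff A y z) \<or>
        (ff A x y = ff A x z \<and> (ff A x z, ff A y z) \<in> less_M lt A) \<or>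
        (ff A x z = ff A y z \<and> (ff A y z, ff A x y) \<in> less_M lt A)) \<and>
     Npart A \<subseteq> Vpart A"

definition fin_gen_over ::
  "('f, 'r) lang \<Rightarrow> ('f, 'r, 'a) struct \<Rightarrow> 'a set \<Rightarrow> 'a set \<Rightarrow> bool" where
  "fin_gen_over L A M0 X \<longleftrightarrow>
     (\<exists>A0. finite A0 \<and> A0 \<subseteq> univ A \<and> X = generated L A A0 \<union> M0)"

text \<open>
  The copy of \<open>M\<close> contained in \<open>F\<close> is its \<open>M\<close>-part.  Members of the class are countable, so up to
  isomorphism all of them occur with a universe consisting of natural numbers.
\<close>

definition fraisse_limit ::
  "('f, 'r) lang \<Rightarrow> 'r \<Rightarrow> ('f, 'r, 'm) struct \<Rightarrow> ('f, 'r, 'a) xstruct \<Rightarrow> bool" where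
  "fraisse_limit L0 lt M F \<longleftrightarrow>
     is_struct (xlang L0) F \<and> countable (univ F) \<and>
     is_struct L0 (Mstruct F) \<and> isomorphic L0 (Mstruct F) M \<and>
     (\<forall>X. fin_gen_over (xlang L0) F (Mpart F) X \<longrightarrow> in_K L0 lt M (restr F X)) \<and>
     (\<forall>B :: ('f, 'r, nat) xstruct. in_K L0 lt M B \<longrightarrow>
        (\<exists>X. fin_gen_over (xlang L0) F (Mpart F) X \<and> isomorphic (xlang L0) (restr F X) B)) \<and>
     (\<forall>X Y h. fin_gen_over (xlang L0) F (Mpart F) X \<and> fin_gen_over (xlang L0) F (Mpart F) Y \<and>
        is_iso (xlang L0) (restr F X) (restr F Y) h \<longrightarrow>
        (\<exists>g. is_iso (xlang L0) F F g \<and> (\<forall>x\<in>X. g x = h x)))"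

text \<open>
  Cofinality and characters of a strict linear order \<open>r\<close>.  Cardinals are cardinal orders on the
  underlying type, determined up to \<open>=o\<close>; that type suffices because the cardinality of the
  order itself already admits a cofinal map.
\<close>

definition cofinal_map :: "'a rel \<Rightarrow> 'a set \<Rightarrow> 'b rel \<Rightarrow> ('b \<Rightarrow> 'a) \<Rightarrow> bool" where
  "cofinal_map r X \<kappa> g \<longleftrightarrow>
     g ` Field \<kappa> \<subseteq> X \<and> (\<forall>x\<in>X. \<exists>i\<in>Field \<kappa>. x = g i \<or> (x, g i) \<in> r)"

definition least_in :: "'a rel set \<Rightarrow> 'a rel" where
  "least_in C = (SOME \<kappa>. \<kappa> \<in> C \<and> (\<forall>\<kappa>'\<in>C. \<kappa> \<le>o \<kappa>'))"

definition cofinality :: "'a set \<Rightarrow> 'a rel \<Rightarrow> 'a rel" where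
  "cofinality X r = least_in {\<kappa>. Card_order \<kappa> \<and> (\<exists>g. cofinal_map r X \<kappa> g)}"

definition left_char :: "'a set \<Rightarrow> 'a rel \<Rightarrow> 'a \<Rightarrow> 'a rel" where
  "left_char X r m = cofinality {n \<in> X. (n, m) \<in> r} r"

definition right_char :: "'a set \<Rightarrow> 'a rel \<Rightarrow> 'a \<Rightarrow> 'a rel" where
  "right_char X r m = cofinality {n \<in> X. (m, n) \<in> r} (r\<inverse>)"

definition point_char :: "'a set \<Rightarrow> 'a rel \<Rightarrow> 'a \<Rightarrow> 'a rel" where
  "point_char X r m = least_in {left_char X r m, right_char X r m}"

definition order_char :: "'a set \<Rightarrow> 'a rel \<Rightarrow> 'a rel" where
  "order_char X r = least_in (point_char X r ` X)"

end

theory Submission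
  imports Defs "HOL-Library.Countable"
begin

text \<open>
  For a point $x$ of the \<open>V\<close>-part, condition (4) makes $y \mapsto f(y,x)$ monotone from the points
  below $x$ into the \<open>M\<close>-part, and $y \mapsto f(x,y)$ antitone on the points above $x$.  In the limit
  both maps are onto the \<open>M\<close>-part: a member of the class with just two \<open>V\<close>-points embeds with any
  prescribed value, and homogeneity moves either of its points to $x$.  Since the \<open>M\<close>-part has no
  greatest element, a cofinal map on either side of $x$ yields one into the \<open>M\<close>-part and conversely,
  so both characters of every point equal the cofinality of the \<open>M\<close>-part.  These properties carry over
  to an uncountable model of the Scott sentence because, by downward Loewenheim-Skolem, any three of
  its elements lie in an embedded copy of the limit.
\<close>

section \<open>Embeddings and isomorphisms\<close>

lemma univ_restr [simp]: "univ (restr A X) = X"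
  and fint_restr [simp]: "fint (restr A X) = fint A"
  and rint_restr [simp]: "rint (restr A X) = rint A"
  by (simp_all add: restr_def)

lemma closed_under_restr [simp]: "closed_under L (restr A X) = closed_under L A"
  by (rule ext) (simp add: closed_under_def)

lemma rel_on_restr [simp]: "rel_on (restr A X) = rel_on A"
  by (intro ext) (simp add: rel_on_def)

lemma tuples_1: "xs \<in> tuples X (Suc 0) \<longleftrightarrow> (\<exists>x\<in>X. xs = [x])"
  by (auto simp: tuples_def length_Suc_conv)

lemma tuples_2: "xs \<in> tuples X 2 \<longleftrightarrow> (\<exists>x\<in>X. \<exists>y\<in>X. xs = [x, y])"
  by (auto simp: tuples_def length_Suc_conv numeral_2_eq_2)

lemma tuples_eq_lists: "tuples X n = {xs \<in> lists X. length xs = n}"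
  by (auto simp: tuples_def)

lemma tuples_mono: "X \<subseteq> Y \<Longrightarrow> tuples X n \<subseteq> tuples Y n"
  by (auto simp: tuples_def)

lemma tuples_image: "tuples (h ` X) n = map h ` tuples X n"
  by (auto simp: tuples_eq_lists lists_image)

definition is_embedding ::
  "('f, 'r) lang \<Rightarrow> ('f, 'r, 'a) struct \<Rightarrow> ('f, 'r, 'b) struct \<Rightarrow> ('a \<Rightarrow> 'b) \<Rightarrow> bool" where
  "is_embedding L A B h \<longleftrightarrow>
     inj_on h (univ A) \<and> h ` univ A \<subseteq> univ B \<and>
     (\<forall>s\<in>funs L. \<forall>xs\<in>tuples (univ A) (fun_ar L s). h (fint A s xs) = fint B s (map h xs)) \<and>
     (\<forall>R\<in>rels L. \<forall>xs\<in>tuples (univ A) (rel_ar L R). rint A R xs \<longleftrightarrow> rint B R (map h xs))"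

lemma is_iso_iff_embedding: "is_iso L A B h \<longleftrightarrow> is_embedding L A B h \<and> h ` univ A = univ B"
  by (auto simp: is_iso_def is_embedding_def bij_betw_def)

lemma iso_restr_imp_embedding:
  assumes "is_iso L A (restr B X) h" "X \<subseteq> univ B"
  shows "is_embedding L A B h"
  using assms by (simp add: is_iso_iff_embedding is_embedding_def)

lemma embedding_unary_rel:
  "is_embedding L A B h \<Longrightarrow> R \<in> rels L \<Longrightarrow> rel_ar L R = Suc 0 \<Longrightarrow> x \<in> univ A \<Longrightarrow>
    rint B R [h x] \<longleftrightarrow> rint A R [x]"
  by (auto simp: is_embedding_def tuples_1)

lemma embedding_binary_rel:
  "is_embedding L A B h \<Longrightarrow> R \<in> rels L \<Longrightarrow> rel_ar L R = 2 \<Longrightarrow> x \<in> univ A \<Longrightarrow> y \<in> univ A \<Longrightarrow>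
    rint B R [h x, h y] \<longleftrightarrow> rint A R [x, y]"
  by (auto simp: is_embedding_def tuples_2)

lemma embedding_binary_fun:
  "is_embedding L A B h \<Longrightarrow> s \<in> funs L \<Longrightarrow> fun_ar L s = 2 \<Longrightarrow> x \<in> univ A \<Longrightarrow> y \<in> univ A \<Longrightarrow>
    fint B s [h x, h y] = h (fint A s [x, y])"
  by (auto simp: is_embedding_def tuples_2)

lemma is_iso_cong:
  assumes h: "is_iso L A B h" and eq: "\<And>x. x \<in> univ A \<Longrightarrow> k x = h x" and A: "is_struct L A"
  shows "is_iso L A B k"
proof -
  have "map k xs = map h xs" if "xs \<in> tuples (univ A) n" for xs n
    using that eq by (auto simp: tuples_def)
  moreover have "k (fint A s xs) = h (fint A s xs)"
    if "s \<in> funs L" "xs \<in> tuples (univ A) (fun_ar L s)" for s xs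
    using that A eq by (simp add: is_struct_def closed_under_def)
  moreover have "bij_betw k (univ A) (univ B)"
    using h eq by (simp add: is_iso_def cong: bij_betw_cong)
  ultimately show ?thesis using h unfolding is_iso_def by (metis (no_types))
qed

lemma is_iso_comp:
  assumes h: "is_iso L A B h" and k: "is_iso L B C k"
  shows "is_iso L A C (k \<circ> h)"
proof -
  have "map h xs \<in> tuples (univ B) n" if "xs \<in> tuples (univ A) n" for xs n
    using that h tuples_image[of h "univ A" n] by (auto simp: is_iso_iff_embedding)
  then show ?thesis
    using h k bij_betw_trans[of h "univ A" "univ B" k "univ C"]
    by (simp add: is_iso_def flip: map_map)
qed

lemma is_iso_inv:
  assumes h: "is_iso L A B h" and A: "is_struct L A"
  shows "is_iso L B A (inv_into (univ A) h)"
proof -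
  let ?k = "inv_into (univ A) h"
  have im: "univ B = h ` univ A" and inj: "inj_on h (univ A)"
    using h by (auto simp: is_iso_def bij_betw_def)
  have kh: "map ?k (map h xs) = xs" if "xs \<in> tuples (univ A) n" for xs n
    using that inj by (auto simp: tuples_def intro!: map_idI)
  have "?k (fint B s (map h xs)) = fint A s (map ?k (map h xs))"
    if "s \<in> funs L" "xs \<in> tuples (univ A) (fun_ar L s)" for s xs
  proof -
    have "fint B s (map h xs) = h (fint A s xs)" using h that by (simp add: is_iso_def)
    moreover have "fint A s xs \<in> univ A" using A that by (simp add: is_struct_def closed_under_def)
    ultimately show ?thesis using inj kh[OF that(2)] by simp
  qed
  moreover have "rint B R (map h xs) \<longleftrightarrow> rint A R (map ?k (map h xs))"
    if "R \<in> rels L" "xs \<in> tuples (univ A) (rel_ar L R)" for R xs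
    using h that kh[OF that(2)] by (simp add: is_iso_def)
  moreover have "bij_betw ?k (univ B) (univ A)"
    using h by (simp add: is_iso_def bij_betw_inv_into)
  ultimately show ?thesis by (simp add: is_iso_def im tuples_image)
qed

lemma isomorphic_sym: "isomorphic L A B \<Longrightarrow> is_struct L A \<Longrightarrow> isomorphic L B A"
  unfolding isomorphic_def using is_iso_inv by blast

lemma isomorphic_trans: "isomorphic L A B \<Longrightarrow> isomorphic L B C \<Longrightarrow> isomorphic L A C"
  unfolding isomorphic_def using is_iso_comp by blast

lemma is_struct_iso:
  assumes "is_iso L A B h" "is_struct L A"
  shows "is_struct L B"
proof -
  have "univ B = h ` univ A" using assms(1) by (simp add: is_iso_iff_embedding)
  moreover have "fint B s (map h xs) \<in> h ` univ A"
    if "s \<in> funs L" "xs \<in> tuples (univ A) (fun_ar L s)" for s xs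
  proof -
    have "fint B s (map h xs) = h (fint A s xs)" using assms(1) that by (simp add: is_iso_def)
    then show ?thesis using assms(2) that by (simp add: is_struct_def closed_under_def)
  qed
  ultimately show ?thesis using assms(2) by (simp add: is_struct_def closed_under_def tuples_image)
qed

definition image_struct :: "('a \<Rightarrow> 'b) \<Rightarrow> ('f, 'r, 'a) struct \<Rightarrow> ('f, 'r, 'b) struct" where
  "image_struct h A = \<lparr>univ = h ` univ A,
     fint = \<lambda>s xs. h (fint A s (map (inv_into (univ A) h) xs)),
     rint = \<lambda>R xs. rint A R (map (inv_into (univ A) h) xs)\<rparr>"

lemma is_iso_image_struct:
  assumes "inj_on h (univ A)"
  shows "is_iso L A (image_struct h A) h"
proof -
  have "map (inv_into (univ A) h) (map h xs) = xs" if "xs \<in> tuples (univ A) n" for xs n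
    using that assms by (auto simp: tuples_def intro!: map_idI)
  then show ?thesis
    using assms by (simp add: is_iso_def image_struct_def bij_betw_def)
qed

section \<open>Satisfaction and isomorphism\<close>

lemma tm_val_in_univ:
  assumes "is_struct L A" "range e \<subseteq> univ A"
  shows "tm_wf L t \<Longrightarrow> tm_val A e t \<in> univ A"
proof (induction t)
  case (App s ts)
  then have "map (tm_val A e) ts \<in> tuples (univ A) (fun_ar L s)" by (auto simp: tuples_def)
  with App.prems assms(1) show ?case by (simp add: is_struct_def closed_under_def)
qed (use assms in auto)

lemma tm_val_iso:
  assumes "is_iso L A B h" "is_struct L A" "range e \<subseteq> univ A"
  shows "tm_wf L t \<Longrightarrow> tm_val B (h \<circ> e) t = h (tm_val A e t)"
proof (induction t)
  case (App s ts)
  have "map (tm_val B (h \<circ> e)) ts = map h (map (tm_val A e) ts)" using App by (simp add: comp_def)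
  moreover have "map (tm_val A e) ts \<in> tuples (univ A) (fun_ar L s)"
    using App.prems tm_val_in_univ[OF assms(2,3)] by (auto simp: tuples_def)
  moreover have "s \<in> funs L" using App.prems by simp
  ultimately show ?case using assms(1) unfolding is_iso_def by (metis tm_val.simps(2))
qed simp

lemma sat_iso:
  assumes h: "is_iso L A B h" and A: "is_struct L A"
  shows "fm_wf L p \<Longrightarrow> range e \<subseteq> univ A \<Longrightarrow> sat B (h \<circ> e) p \<longleftrightarrow> sat A e p"
proof (induction p arbitrary: e)
  case (FEq t u)
  have "inj_on h (univ A)" using h by (simp add: is_iso_def bij_betw_def)
  moreover have "tm_val A e t \<in> univ A" "tm_val A e u \<in> univ A"
    using FEq tm_val_in_univ[OF A] by auto
  ultimately show ?case
    using FEq tm_val_iso[OF h A FEq.prems(2)] by (simp add: inj_on_eq_iff comp_def)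
next
  case (FRel R ts)
  have "map (tm_val B (h \<circ> e)) ts = map h (map (tm_val A e) ts)"
    using FRel tm_val_iso[OF h A] by auto
  moreover have "map (tm_val A e) ts \<in> tuples (univ A) (rel_ar L R)"
    using FRel tm_val_in_univ[OF A] by (auto simp: tuples_def)
  moreover have "R \<in> rels L" using FRel by simp
  ultimately show ?case using h unfolding is_iso_def by (metis sat.simps(2))
next
  case (FEx i p)
  have im: "univ B = h ` univ A" using h by (simp add: is_iso_iff_embedding)
  have "sat B ((h \<circ> e)(i := h a)) p \<longleftrightarrow> sat A (e(i := a)) p" if "a \<in> univ A" for a
  proof -
    have "sat B (h \<circ> e(i := a)) p \<longleftrightarrow> sat A (e(i := a)) p"
      using FEx.prems that by (intro FEx.IH) auto
    moreover have "h \<circ> e(i := a) = (h \<circ> e)(i := h a)" by auto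
    ultimately show ?thesis by simp
  qed
  then show ?case unfolding sat.simps im by blast
qed auto

lemma model_of_iso:
  assumes h: "is_iso L A B h" and A: "model_of L p A" and p: "fm_wf L p"
  shows "model_of L p B"
  unfolding model_of_def
proof (intro conjI allI impI)
  have struct: "is_struct L A" using A by (simp add: model_of_def)
  with h show "is_struct L B" by (rule is_struct_iso)
  fix e :: "nat \<Rightarrow> 'd" assume "range e \<subseteq> univ B"
  then have e: "e i \<in> h ` univ A" for i using h by (auto simp: is_iso_iff_embedding)
  let ?e = "inv_into (univ A) h \<circ> e"
  have "range ?e \<subseteq> univ A" using inv_into_into[OF e] by auto
  moreover from this have "sat A ?e p" using A by (simp add: model_of_def)
  ultimately have "sat B (h \<circ> ?e) p" using sat_iso[OF h struct p] by blast
  moreover have "h \<circ> ?e = e" using f_inv_into_f[OF e] by auto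
  ultimately show "sat B e p" by simp
qed

section \<open>The downward Loewenheim-Skolem theorem\<close>

lemma tm_val_restr [simp]: "tm_val (restr A X) e = tm_val A e"
proof
  show "tm_val (restr A X) e t = tm_val A e t" for t
    by (induction t) (simp_all cong: map_cong)
qed

lemma tm_val_cong: "(\<And>i. i \<in> tm_vars t \<Longrightarrow> e i = e' i) \<Longrightarrow> tm_val A e t = tm_val A e' t"
proof (induction t)
  case (App s ts)
  then have "map (tm_val A e) ts = map (tm_val A e') ts" by auto
  then show ?case by (simp only: tm_val.simps)
qed simp

lemma sat_cong:
  "(\<And>i. i \<in> free_vars p \<Longrightarrow> e i = e' i) \<Longrightarrow> sat A e p \<longleftrightarrow> sat A e' p"
proof (induction p arbitrary: e e')
  case (FEq t u)
  then have "tm_val A e t = tm_val A e' t" "tm_val A e u = tm_val A e' u"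
    by (auto intro: tm_val_cong)
  then show ?case by simp
next
  case (FRel R ts)
  then have "map (tm_val A e) ts = map (tm_val A e') ts" by (auto intro: tm_val_cong)
  then show ?case by (simp only: sat.simps)
next
  case (FNot p)
  then have "sat A e p \<longleftrightarrow> sat A e' p" by (metis free_vars.simps(3))
  then show ?case by simp
next
  case (FConj ps)
  have "sat A e (ps n) \<longleftrightarrow> sat A e' (ps n)" for n
    using FConj.IH[of "ps n" e e'] FConj.prems by auto
  then show ?case by simp
next
  case (FEx i p)
  have "sat A (e(i := a)) p \<longleftrightarrow> sat A (e'(i := a)) p" for a
    using FEx.prems by (intro FEx.IH) auto
  then show ?case by simp
qed

definition closed_operations :: "('a list \<Rightarrow> 'a) set \<Rightarrow> 'a set \<Rightarrow> bool" where
  "closed_operations H X \<longleftrightarrow> (\<forall>h\<in>H. \<forall>xs\<in>lists X. h xs \<in> X)"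

instance tm :: (countable) countable
  by countable_datatype

text \<open>The closure consists of the values of the countably many terms in the operations.\<close>

lemma countable_closure_under_operations:
  assumes H: "countable H" "closed_operations H U" and S: "countable S" "S \<noteq> {}" "S \<subseteq> U"
  obtains X where "countable X" "S \<subseteq> X" "X \<subseteq> U" "closed_operations H X"
proof -
  obtain c where c: "c \<in> S" using S(2) by blast
  let ?H = "insert (\<lambda>_. c) H"
  let ?A = "\<lparr>univ = U, fint = from_nat_into ?H, rint = \<lambda>(_ :: unit) _. False\<rparr>"
  define val where "val = tm_val ?A (from_nat_into S)"
  have val_Var: "val (Var i) = from_nat_into S i" for i by (simp add: val_def)
  have val_App: "val (App n ts) = from_nat_into ?H n (map val ts)" for n ts by (simp add: val_def)
  have H_range: "range (from_nat_into ?H) = ?H" using H(1) by (intro range_from_nat_into) auto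
  have S_range: "range (from_nat_into S) = S" using S by (intro range_from_nat_into)
  have "range (from_nat_into S) \<subseteq> range val" by (auto simp flip: val_Var)
  then have "S \<subseteq> range val" by (simp only: S_range)
  moreover have "val t \<in> U" for t
  proof (induction t)
    case (Var i)
    then show ?case using S_range S(3) by (auto simp: val_Var)
  next
    case (App n ts)
    then have "map val ts \<in> lists U" by auto
    moreover have "from_nat_into ?H n \<in> ?H" using H_range by blast
    ultimately show ?case using H(2) c S(3) by (auto simp: val_App closed_operations_def)
  qed
  moreover have "h xs \<in> range val" if h: "h \<in> H" and xs: "xs \<in> lists (range val)" for h xs
  proof -
    obtain n where "h = from_nat_into ?H n" using h H_range by blast
    moreover obtain ts where "xs = map val ts" using xs by (auto simp: lists_image)
    ultimately have "h xs = val (App n ts)" by (simp add: val_App)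
    then show ?thesis by blast
  qed
  then have "closed_operations H (range val)" by (simp add: closed_operations_def)
  ultimately show ?thesis using that[of "range val"] by auto
qed

definition Skolem_operations ::
  "('f, 'r, 'a) struct \<Rightarrow> ('f, 'r) fm \<Rightarrow> ('a list \<Rightarrow> 'a) set \<Rightarrow> bool" where
  "Skolem_operations A p H \<longleftrightarrow>
     countable H \<and> closed_operations H (univ A) \<and>
     (\<forall>X e. X \<subseteq> univ A \<and> closed_operations H X \<and> range e \<subseteq> X \<longrightarrow>
       (sat (restr A X) e p \<longleftrightarrow> sat A e p))"

lemma Skolem_operations_FConj:
  assumes "\<And>n. Skolem_operations A (ps n) (H n)"
  shows "Skolem_operations A (FConj ps) (\<Union>n. H n)"
proof -
  have "sat (restr A X) e (ps n) \<longleftrightarrow> sat A e (ps n)"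
    if "X \<subseteq> univ A" "closed_operations (\<Union>n. H n) X" "range e \<subseteq> X" for X e n
  proof -
    have "closed_operations (H n) X" using that(2) by (auto simp: closed_operations_def)
    with that assms[of n] show ?thesis by (simp add: Skolem_operations_def)
  qed
  moreover have "countable (\<Union>n. H n)" "closed_operations (\<Union>n. H n) (univ A)"
    using assms by (auto simp: Skolem_operations_def closed_operations_def)
  ultimately show ?thesis by (auto simp: Skolem_operations_def)
qed

lemma Skolem_function:
  fixes A :: "('f, 'r, 'a) struct"
  assumes "univ A \<noteq> {}" "finite (free_vars p)"
  obtains w where "\<And>xs. w xs \<in> univ A"
    "\<And>X e. \<lbrakk>range e \<subseteq> X; closed_operations {w} X; sat A e (FEx i p)\<rbrakk> \<Longrightarrow> \<exists>a\<in>X. sat A (e(i := a)) p"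
proof -
  have "\<forall>xs. \<exists>a\<in>univ A. (\<exists>b\<in>univ A. sat A (((!) xs)(i := b)) p) \<longrightarrow> sat A (((!) xs)(i := a)) p"
    using assms(1) by blast
  then obtain w where w: "\<And>xs. w xs \<in> univ A"
    "\<And>xs b. b \<in> univ A \<Longrightarrow> sat A (((!) xs)(i := b)) p \<Longrightarrow> sat A (((!) xs)(i := w xs)) p"
    by metis
  obtain n where n: "free_vars p \<subseteq> {..<n}" using assms(2) finite_nat_iff_bounded by blast
  have "\<exists>a\<in>X. sat A (e(i := a)) p"
    if e: "range e \<subseteq> X" and X: "closed_operations {w} X" and ex: "sat A e (FEx i p)" for X e
  proof -
    let ?xs = "map e [0..<n]"
    have env: "sat A (((!) ?xs)(i := a)) p \<longleftrightarrow> sat A (e(i := a)) p" for a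
      by (rule sat_cong) (use n in auto)
    have "?xs \<in> lists X" using e by (auto simp: image_subset_iff)
    then have "w ?xs \<in> X" using X by (auto simp: closed_operations_def)
    moreover have "sat A (e(i := w ?xs)) p" using ex w(2)[of _ ?xs] unfolding env by auto
    ultimately show ?thesis by blast
  qed
  with w(1) that show ?thesis by blast
qed

lemma Skolem_operations_FEx:
  assumes H: "Skolem_operations A p H" and A: "univ A \<noteq> {}" and p: "finite (free_vars p)"
  obtains w where "Skolem_operations A (FEx i p) (insert w H)"
proof -
  obtain w where w: "\<And>xs. w xs \<in> univ A"
    "\<And>X e. \<lbrakk>range e \<subseteq> X; closed_operations {w} X; sat A e (FEx i p)\<rbrakk> \<Longrightarrow> \<exists>a\<in>X. sat A (e(i := a)) p"
    using Skolem_function[OF A p] by blast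
  have "sat (restr A X) e (FEx i p) \<longleftrightarrow> sat A e (FEx i p)"
    if X: "X \<subseteq> univ A" and closed: "closed_operations (insert w H) X" and e: "range e \<subseteq> X" for X e
  proof -
    have "closed_operations H X" "closed_operations {w} X"
      using closed by (auto simp: closed_operations_def)
    moreover have "range (e(i := a)) \<subseteq> X" if "a \<in> X" for a using e that by auto
    ultimately have "sat (restr A X) (e(i := a)) p \<longleftrightarrow> sat A (e(i := a)) p" if "a \<in> X" for a
      using H X that by (simp add: Skolem_operations_def)
    then show ?thesis using w(2)[OF e \<open>closed_operations {w} X\<close>] X by auto
  qed
  moreover have "countable (insert w H)" "closed_operations (insert w H) (univ A)"
    using H w(1) by (auto simp: Skolem_operations_def closed_operations_def)
  ultimately have "Skolem_operations A (FEx i p) (insert w H)"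
    unfolding Skolem_operations_def by blast
  then show ?thesis by (rule that)
qed

lemma Skolem_operations_exist:
  assumes "univ A \<noteq> {}" "finite (free_vars p)"
  shows "\<exists>H. Skolem_operations A p H"
  using assms(2)
proof (induction p)
  case (FEq t u)
  have "Skolem_operations A (FEq t u) {}"
    by (simp add: Skolem_operations_def closed_operations_def)
  then show ?case by blast
next
  case (FRel R ts)
  have "Skolem_operations A (FRel R ts) {}"
    by (simp add: Skolem_operations_def closed_operations_def)
  then show ?case by blast
next
  case (FNot p)
  then show ?case by (simp add: Skolem_operations_def)
next
  case (FConj ps)
  have "\<exists>H. Skolem_operations A (ps n) H" for n
  proof (rule FConj.IH)
    show "finite (free_vars (ps n))" by (rule finite_subset[OF _ FConj.prems]) auto
  qed auto
  then obtain H where "\<And>n. Skolem_operations A (ps n) (H n)" by metis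
  then show ?case using Skolem_operations_FConj by blast
next
  case (FEx i p)
  then have "finite (free_vars p)" by simp
  with FEx.IH obtain H where "Skolem_operations A p H" by blast
  from Skolem_operations_FEx[OF this assms(1) \<open>finite (free_vars p)\<close>] show ?case by blast
qed

theorem downward_Loewenheim_Skolem:
  assumes L: "countable (funs L)" and p: "sentence L p" and A: "model_of L p A"
    and S: "countable S" "S \<subseteq> univ A"
  obtains X where "countable X" "S \<subseteq> X" "X \<subseteq> univ A" "model_of L p (restr A X)"
proof -
  have struct: "is_struct L A" using A by (simp add: model_of_def)
  then obtain u where u: "u \<in> univ A" by (auto simp: is_struct_def)
  have "univ A \<noteq> {}" "finite (free_vars p)" using p u by (auto simp: sentence_def)
  then have "\<exists>H. Skolem_operations A p H" by (rule Skolem_operations_exist)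
  then obtain H where H: "Skolem_operations A p H" by blast
  define op where "op s xs = (if length xs = fun_ar L s then fint A s xs else u)" for s xs
  have "countable (H \<union> op ` funs L)" using H L by (simp add: Skolem_operations_def)
  moreover have "op s xs \<in> univ A" if "s \<in> funs L" "xs \<in> lists (univ A)" for s xs
    using struct u that by (simp add: is_struct_def closed_under_def tuples_eq_lists op_def)
  then have "closed_operations (H \<union> op ` funs L) (univ A)"
    using H by (auto simp: Skolem_operations_def closed_operations_def)
  moreover have "countable (insert u S)" "insert u S \<noteq> {}" "insert u S \<subseteq> univ A" using S u by auto
  ultimately obtain X where X: "countable X" "insert u S \<subseteq> X" "X \<subseteq> univ A"
    and closed: "closed_operations (H \<union> op ` funs L) X"
    by (rule countable_closure_under_operations)
  have "fint A s xs \<in> X" if "s \<in> funs L" "xs \<in> tuples X (fun_ar L s)" for s xs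
  proof -
    have "op s xs \<in> X" using closed that by (auto simp: closed_operations_def tuples_def)
    then show ?thesis using that(2) by (simp add: op_def tuples_def)
  qed
  then have "is_struct L (restr A X)" using X(2) by (auto simp: is_struct_def closed_under_def)
  moreover have "sat (restr A X) e p" if "range e \<subseteq> X" for e
  proof -
    have "closed_operations H X" using closed by (auto simp: closed_operations_def)
    then have "sat (restr A X) e p \<longleftrightarrow> sat A e p"
      using H X(3) that by (simp add: Skolem_operations_def)
    moreover have "sat A e p" using A that X(3) by (auto simp: model_of_def)
    ultimately show ?thesis by simp
  qed
  ultimately have "model_of L p (restr A X)" by (simp add: model_of_def)
  then show ?thesis using that X by auto
qed

theorem scott_sentence_embedding:
  assumes L: "countable (funs L)" and scott: "scott_sentence L A p" and G: "model_of L p G"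
    and S: "countable S" "S \<subseteq> univ G"
  shows "\<exists>h. is_embedding L A G h \<and> S \<subseteq> h ` univ A"
proof -
  have p: "sentence L p" "fm_wf L p" using scott by (auto simp: scott_sentence_def sentence_def)
  obtain X where X: "countable X" "S \<subseteq> X" "X \<subseteq> univ G" "model_of L p (restr G X)"
    using downward_Loewenheim_Skolem[OF L p(1) G S] .
  let ?B = "image_struct (to_nat_on X) (restr G X)"
  have B: "is_iso L (restr G X) ?B (to_nat_on X)"
    using X(1) by (intro is_iso_image_struct) (simp add: inj_on_to_nat_on)
  then have "model_of L p ?B" using X(4) p(2) by (rule model_of_iso)
  then have "isomorphic L A ?B" using scott by (simp add: scott_sentence_def)
  moreover have "isomorphic L ?B (restr G X)"
    using B X(4) by (auto simp: model_of_def isomorphic_def intro: is_iso_inv)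
  ultimately have "isomorphic L A (restr G X)" by (rule isomorphic_trans)
  then obtain h where h: "is_iso L A (restr G X) h" by (auto simp: isomorphic_def)
  then have "h ` univ A = X" by (simp add: is_iso_iff_embedding)
  with iso_restr_imp_embedding[OF h X(3)] X(2) show ?thesis by blast
qed

section \<open>Cofinalities\<close>

lemma least_in_mem:
  assumes "C \<noteq> {}" "\<forall>\<kappa>\<in>C. Card_order \<kappa>"
  shows "least_in C \<in> C"
proof -
  have "\<exists>\<kappa>. \<kappa> \<in> C \<and> (\<forall>\<kappa>'\<in>C. \<kappa> \<le>o \<kappa>')"
    using exists_minim_Card_order[OF assms] by blast
  from someI_ex[OF this] show ?thesis unfolding least_in_def by (rule conjunct1)
qed

lemma least_in_singleton: "Card_order \<kappa> \<Longrightarrow> least_in {\<kappa>} = \<kappa>"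
  using least_in_mem[of "{\<kappa>}"] by simp

lemma Card_order_cofinality:
  fixes X :: "'a set"
  shows "Card_order (cofinality X r)"
proof -
  let ?C = "{\<kappa> :: 'a rel. Card_order \<kappa> \<and> (\<exists>g. cofinal_map r X \<kappa> g)}"
  have "cofinal_map r X (card_of X) id" by (auto simp: cofinal_map_def Field_card_of)
  then have "card_of X \<in> ?C" using card_of_Card_order by blast
  then have "least_in ?C \<in> ?C" by (intro least_in_mem) auto
  then show ?thesis by (simp add: cofinality_def)
qed

lemma cofinal_map_image:
  assumes f: "f ` X = Y"
    and mono: "\<And>x x'. (x, x') \<in> r \<Longrightarrow> x \<in> X \<Longrightarrow> x' \<in> X \<Longrightarrow> (f x, f x') \<in> s\<^sup>="
    and g: "cofinal_map r X \<kappa> g"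
  shows "cofinal_map s Y \<kappa> (f \<circ> g)"
  unfolding cofinal_map_def
proof (intro conjI ballI)
  show "(f \<circ> g) ` Field \<kappa> \<subseteq> Y" using f g by (auto simp: cofinal_map_def)
  fix y assume "y \<in> Y"
  then obtain x where x: "x \<in> X" "y = f x" using f by blast
  then obtain i where i: "i \<in> Field \<kappa>" "x = g i \<or> (x, g i) \<in> r" "g i \<in> X"
    using g unfolding cofinal_map_def by blast
  then show "\<exists>i\<in>Field \<kappa>. y = (f \<circ> g) i \<or> (y, (f \<circ> g) i) \<in> s"
    using mono[of x "g i"] x by auto
qed

lemma cofinal_map_lift:
  assumes s: "trans s" "irrefl s" and no_greatest: "\<And>y. y \<in> Y \<Longrightarrow> \<exists>y'\<in>Y. (y, y') \<in> s"
    and f: "f ` X = Y" and r: "total_on X r"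
    and mono: "\<And>x x'. (x, x') \<in> r \<Longrightarrow> x \<in> X \<Longrightarrow> x' \<in> X \<Longrightarrow> (f x, f x') \<in> s\<^sup>="
    and g: "cofinal_map s Y \<kappa> g"
  obtains k where "cofinal_map r X \<kappa> k"
proof -
  have "\<exists>x\<in>X. (g i, f x) \<in> s" if "i \<in> Field \<kappa>" for i
    using no_greatest[of "g i"] that g f unfolding cofinal_map_def by blast
  then obtain k where k: "\<And>i. i \<in> Field \<kappa> \<Longrightarrow> k i \<in> X \<and> (g i, f (k i)) \<in> s" by metis
  have "\<exists>i\<in>Field \<kappa>. x = k i \<or> (x, k i) \<in> r" if x: "x \<in> X" for x
  proof -
    obtain i where i: "i \<in> Field \<kappa>" "f x = g i \<or> (f x, g i) \<in> s"
      using g f x unfolding cofinal_map_def by blast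
    then have less: "(f x, f (k i)) \<in> s" using k[OF i(1)] transD[OF s(1)] by metis
    have "(k i, x) \<notin> r"
    proof
      assume "(k i, x) \<in> r"
      then have "(f (k i), f x) \<in> s\<^sup>=" using mono k i(1) x by blast
      then have "(f x, f x) \<in> s" using less transD[OF s(1)] by auto
      then show False using s(2) by (simp add: irrefl_def)
    qed
    then show ?thesis using r k[OF i(1)] x i(1) unfolding total_on_def by blast
  qed
  then have "cofinal_map r X \<kappa> k" using k by (auto simp: cofinal_map_def)
  then show ?thesis by (rule that)
qed

lemma cofinality_monotone_image:
  fixes r s :: "'a rel"
  assumes "trans s" "irrefl s" "\<And>y. y \<in> Y \<Longrightarrow> \<exists>y'\<in>Y. (y, y') \<in> s" "f ` X = Y" "total_on X r"
    and "\<And>x x'. (x, x') \<in> r \<Longrightarrow> x \<in> X \<Longrightarrow> x' \<in> X \<Longrightarrow> (f x, f x') \<in> s\<^sup>="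
  shows "cofinality X r = cofinality Y s"
proof -
  have "(\<exists>g. cofinal_map r X \<kappa> g) \<longleftrightarrow> (\<exists>g. cofinal_map s Y \<kappa> g)" for \<kappa> :: "'a rel"
  proof
    show "\<exists>g. cofinal_map s Y \<kappa> g" if "\<exists>g. cofinal_map r X \<kappa> g"
      using that cofinal_map_image[OF assms(4,6)] by blast
    show "\<exists>g. cofinal_map r X \<kappa> g" if "\<exists>g. cofinal_map s Y \<kappa> g"
      using that cofinal_map_lift[OF assms] by blast
  qed
  then show ?thesis by (simp add: cofinality_def)
qed

section \<open>Structures in which the function takes every value on both sides of every point\<close>

locale full_value_structure =
  fixes lt :: 'r and A :: "('f, 'r, 'a) xstruct"
  assumes V_nonempty: "Vpart A \<noteq> {}"
    and V_linear: "strict_linear_order_on (Vpart A) (tri A)"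
    and M_linear: "strict_linear_order_on (Mpart A) (less_M lt A)"
    and M_no_greatest: "m \<in> Mpart A \<Longrightarrow> \<exists>m'\<in>Mpart A. (m, m') \<in> less_M lt A"
    and value_in_M: "(x, y) \<in> tri A \<Longrightarrow> ff A x y \<in> Mpart A"
    and value_mono: "(x, y) \<in> tri A \<Longrightarrow> (y, z) \<in> tri A \<Longrightarrow> (ff A x z, ff A y z) \<in> (less_M lt A)\<^sup>="
    and value_antimono: "(x, y) \<in> tri A \<Longrightarrow> (y, z) \<in> tri A \<Longrightarrow> (ff A x z, ff A x y) \<in> (less_M lt A)\<^sup>="
    and value_below: "x \<in> Vpart A \<Longrightarrow> m \<in> Mpart A \<Longrightarrow> \<exists>y. (y, x) \<in> tri A \<and> ff A y x = m"
    and value_above: "x \<in> Vpart A \<Longrightarrow> m \<in> Mpart A \<Longrightarrow> \<exists>y. (x, y) \<in> tri A \<and> ff A x y = m"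
begin

lemma total_on_subset_V:
  assumes "X \<subseteq> Vpart A"
  shows "total_on X (tri A)"
  using assms V_linear by (auto simp: strict_linear_order_on_def total_on_def)

lemma less_M_trans: "trans (less_M lt A)" and less_M_irrefl: "irrefl (less_M lt A)"
  using M_linear by (simp_all add: strict_linear_order_on_def)

lemma left_char_eq_cofinality:
  assumes x: "x \<in> Vpart A"
  shows "left_char (Vpart A) (tri A) x = cofinality (Mpart A) (less_M lt A)"
  unfolding left_char_def
proof (rule cofinality_monotone_image[OF less_M_trans less_M_irrefl M_no_greatest])
  let ?L = "{y \<in> Vpart A. (y, x) \<in> tri A}"
  show "(\<lambda>y. ff A y x) ` ?L = Mpart A"
    using value_below[OF x] value_in_M by (fastforce simp: rel_on_def)
  show "total_on ?L (tri A)" by (rule total_on_subset_V) auto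
  show "(ff A y x, ff A y' x) \<in> (less_M lt A)\<^sup>=" if "(y, y') \<in> tri A" "y \<in> ?L" "y' \<in> ?L" for y y'
    using value_mono[of y y' x] that by simp
qed

lemma right_char_eq_cofinality:
  assumes x: "x \<in> Vpart A"
  shows "right_char (Vpart A) (tri A) x = cofinality (Mpart A) (less_M lt A)"
  unfolding right_char_def
proof (rule cofinality_monotone_image[OF less_M_trans less_M_irrefl M_no_greatest])
  let ?R = "{y \<in> Vpart A. (x, y) \<in> tri A}"
  show "ff A x ` ?R = Mpart A"
    using value_above[OF x] value_in_M by (fastforce simp: rel_on_def)
  show "total_on ?R ((tri A)\<inverse>)" using total_on_subset_V[of ?R] by auto
  show "(ff A x y, ff A x y') \<in> (less_M lt A)\<^sup>=" if "(y, y') \<in> (tri A)\<inverse>" "y \<in> ?R" "y' \<in> ?R" for y y'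
    using value_antimono[of x y' y] that by simp
qed

theorem order_char_eq_cofinality:
  "order_char (Vpart A) (tri A) = cofinality (Mpart A) (less_M lt A)"
proof -
  let ?c = "cofinality (Mpart A) (less_M lt A)"
  have "point_char (Vpart A) (tri A) x = ?c" if "x \<in> Vpart A" for x
    using left_char_eq_cofinality[OF that] right_char_eq_cofinality[OF that]
    by (simp add: point_char_def least_in_singleton Card_order_cofinality)
  then have "point_char (Vpart A) (tri A) ` Vpart A = {?c}" using V_nonempty by auto
  then show ?thesis by (simp add: order_char_def least_in_singleton Card_order_cofinality)
qed

end

section \<open>The expanded language\<close>

lemma xlang_simps [simp]:
  "F_sym \<in> funs (xlang L0)" "OldR R \<in> rels (xlang L0) \<longleftrightarrow> R \<in> rels L0" "V_sym \<in> rels (xlang L0)"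
  "M_sym \<in> rels (xlang L0)" "N_sym \<in> rels (xlang L0)" "Tri_sym \<in> rels (xlang L0)"
  "fun_ar (xlang L0) (OldF s) = fun_ar L0 s" "fun_ar (xlang L0) F_sym = 2"
  "rel_ar (xlang L0) (OldR R) = rel_ar L0 R" "rel_ar (xlang L0) V_sym = Suc 0"
  "rel_ar (xlang L0) M_sym = Suc 0" "rel_ar (xlang L0) N_sym = Suc 0"
  "rel_ar (xlang L0) Tri_sym = 2"
  by (auto simp: xlang_def)

lemma ball_funs_xlang: "(\<forall>s\<in>funs (xlang L0). P s) \<longleftrightarrow> (\<forall>s\<in>funs L0. P (OldF s)) \<and> P F_sym"
  by (auto simp: xlang_def)

lemma ball_rels_xlang:
  "(\<forall>R\<in>rels (xlang L0). P R) \<longleftrightarrow>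
    (\<forall>R\<in>rels L0. P (OldR R)) \<and> P V_sym \<and> P M_sym \<and> P N_sym \<and> P Tri_sym"
  by (auto simp: xlang_def)

lemma is_iso_xlang_iff:
  "is_iso (xlang L0) A B h \<longleftrightarrow>
     bij_betw h (univ A) (univ B) \<and>
     (\<forall>s\<in>funs L0. \<forall>xs\<in>tuples (univ A) (fun_ar L0 s).
        h (fint A (OldF s) xs) = fint B (OldF s) (map h xs)) \<and>
     (\<forall>R\<in>rels L0. \<forall>xs\<in>tuples (univ A) (rel_ar L0 R).
        rint A (OldR R) xs \<longleftrightarrow> rint B (OldR R) (map h xs)) \<and>
     (\<forall>x\<in>univ A. \<forall>y\<in>univ A. h (ff A x y) = ff B (h x) (h y)) \<and>
     (\<forall>x\<in>univ A. \<forall>y\<in>univ A. rint A Tri_sym [x, y] \<longleftrightarrow> rint B Tri_sym [h x, h y]) \<and>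
     (\<forall>S\<in>{V_sym, M_sym, N_sym}. \<forall>x\<in>univ A. rint A S [x] \<longleftrightarrow> rint B S [h x])"
  unfolding is_iso_def ball_funs_xlang ball_rels_xlang by (auto simp: tuples_1 tuples_2)

lemma countable_funs_xlang: "countable_lang L0 \<Longrightarrow> countable (funs (xlang L0))"
  by (simp add: countable_lang_def xlang_def)

lemma univ_Mstruct [simp]: "univ (Mstruct A) = Mpart A"
  and fint_Mstruct [simp]: "fint (Mstruct A) s = fint A (OldF s)"
  and rint_Mstruct [simp]: "rint (Mstruct A) R = rint A (OldR R)"
  by (simp_all add: Mstruct_def)

lemma parts_subset_univ: "Vpart A \<subseteq> univ A" "Mpart A \<subseteq> univ A" "Npart A \<subseteq> univ A"
  by (auto simp: Vpart_def Mpart_def Npart_def)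

lemma parts_restr:
  assumes "X \<subseteq> univ A"
  shows "Vpart (restr A X) = Vpart A \<inter> X" "Mpart (restr A X) = Mpart A \<inter> X"
    "Npart (restr A X) = Npart A \<inter> X"
  using assms by (auto simp: Vpart_def Mpart_def Npart_def)

lemma Mstruct_restr:
  assumes "Mpart A \<subseteq> X" "X \<subseteq> univ A"
  shows "Mstruct (restr A X) = Mstruct A"
  using assms by (auto simp: Mstruct_def Mpart_def)

lemma embedding_parts:
  assumes "is_embedding (xlang L0) A B h" "x \<in> univ A"
  shows "h x \<in> Vpart B \<longleftrightarrow> x \<in> Vpart A" "h x \<in> Mpart B \<longleftrightarrow> x \<in> Mpart A"
    "h x \<in> Npart B \<longleftrightarrow> x \<in> Npart A"
proof -
  have "h x \<in> univ B" using assms by (auto simp: is_embedding_def)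
  then show "h x \<in> Vpart B \<longleftrightarrow> x \<in> Vpart A" "h x \<in> Mpart B \<longleftrightarrow> x \<in> Mpart A"
    "h x \<in> Npart B \<longleftrightarrow> x \<in> Npart A"
    using assms embedding_unary_rel[OF assms(1)] by (simp_all add: Vpart_def Mpart_def Npart_def)
qed

lemma embedding_image_parts:
  assumes "is_embedding (xlang L0) A B h"
  shows "h ` univ A \<inter> Vpart B = h ` Vpart A" "h ` univ A \<inter> Mpart B = h ` Mpart A"
  using embedding_parts[OF assms] parts_subset_univ[of A] by blast+

lemma embedding_value:
  assumes "is_embedding (xlang L0) A B h" "x \<in> univ A" "y \<in> univ A"
  shows "ff B (h x) (h y) = h (ff A x y)"
  using assms by (simp add: embedding_binary_fun)

lemma embedding_tri:
  assumes "is_embedding (xlang L0) A B h" "x \<in> univ A" "y \<in> univ A"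
  shows "(h x, h y) \<in> tri B \<longleftrightarrow> (x, y) \<in> tri A"
  using assms embedding_parts[OF assms(1)] by (simp add: rel_on_def embedding_binary_rel)

lemma embedding_less_M:
  assumes "is_embedding (xlang L0) A B h" "lt \<in> rels L0" "rel_ar L0 lt = 2"
    and "x \<in> univ A" "y \<in> univ A"
  shows "(h x, h y) \<in> less_M lt B \<longleftrightarrow> (x, y) \<in> less_M lt A"
  using assms embedding_parts[OF assms(1)] by (simp add: rel_on_def embedding_binary_rel)

lemma trivial_off_domainD:
  assumes "trivial_off_domain L0 A"
  shows "\<And>R xs. R \<in> rels L0 \<Longrightarrow> xs \<in> tuples (univ A) (rel_ar L0 R) \<Longrightarrow> rint A (OldR R) xs \<Longrightarrow>
      set xs \<subseteq> Mpart A"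
    and "\<And>s xs. s \<in> funs L0 \<Longrightarrow> xs \<in> tuples (univ A) (fun_ar L0 s) \<Longrightarrow> \<not> set xs \<subseteq> Mpart A \<Longrightarrow>
      fint A (OldF s) xs = hd xs"
    and "\<And>x y. x \<in> univ A \<Longrightarrow> y \<in> univ A \<Longrightarrow> rint A Tri_sym [x, y] \<longleftrightarrow> (x, y) \<in> tri A"
    and "\<And>x y. x \<in> univ A \<Longrightarrow> y \<in> univ A \<Longrightarrow> \<not> (x \<in> Vpart A \<and> y \<in> Vpart A \<and> x \<noteq> y) \<Longrightarrow> ff A x y = x"
  using assms unfolding trivial_off_domain_def rel_on_def by (simp_all, blast+)

lemma is_iso_Mstruct:
  assumes h: "is_iso (xlang L0) A B h"
  shows "is_iso L0 (Mstruct A) (Mstruct B) h"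
proof -
  have emb: "is_embedding (xlang L0) A B h" and im: "h ` univ A = univ B"
    using h by (simp_all add: is_iso_iff_embedding)
  have "h ` Mpart A = Mpart B"
    using embedding_image_parts(2)[OF emb] by (simp add: im Int_absorb1 parts_subset_univ)
  moreover have "inj_on h (Mpart A)"
    by (rule inj_on_subset[OF _ parts_subset_univ(2)]) (use emb in \<open>simp add: is_embedding_def\<close>)
  moreover have "tuples (Mpart A) n \<subseteq> tuples (univ A) n" for n
    by (rule tuples_mono[OF parts_subset_univ(2)])
  ultimately show ?thesis
    using h[unfolded is_iso_xlang_iff] by (simp add: is_iso_def bij_betw_def subset_eq)
qed

lemma trivial_off_domain_iso_old_symbols:
  assumes off: "trivial_off_domain L0 A" "trivial_off_domain L0 B"
    and bij: "bij_betw h (univ A) (univ B)" and iso: "is_iso L0 (Mstruct A) (Mstruct B) h"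
  shows "\<And>s xs. s \<in> funs L0 \<Longrightarrow> xs \<in> tuples (univ A) (fun_ar L0 s) \<Longrightarrow>
      h (fint A (OldF s) xs) = fint B (OldF s) (map h xs)"
    and "\<And>R xs. R \<in> rels L0 \<Longrightarrow> xs \<in> tuples (univ A) (rel_ar L0 R) \<Longrightarrow>
      rint A (OldR R) xs \<longleftrightarrow> rint B (OldR R) (map h xs)"
    and "\<And>x. x \<in> univ A \<Longrightarrow> h x \<in> Mpart B \<longleftrightarrow> x \<in> Mpart A"
proof -
  note A = trivial_off_domainD[OF off(1)] and B = trivial_off_domainD[OF off(2)]
  have im: "h ` univ A = univ B" and inj: "inj_on h (univ A)"
    using bij by (simp_all add: bij_betw_def)
  have "h ` Mpart A = Mpart B" using iso by (simp add: is_iso_iff_embedding)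
  then show M: "h x \<in> Mpart B \<longleftrightarrow> x \<in> Mpart A" if "x \<in> univ A" for x
    using inj_on_image_mem_iff[OF inj that parts_subset_univ(2)] by simp
  then have M_tuple: "set (map h xs) \<subseteq> Mpart B \<longleftrightarrow> set xs \<subseteq> Mpart A"
    if "xs \<in> tuples (univ A) n" for xs n
    using that by (auto simp: tuples_def)
  have map_h: "map h xs \<in> tuples (univ B) n" if "xs \<in> tuples (univ A) n" for xs n
    using that by (simp add: tuples_image flip: im)
  show "h (fint A (OldF s) xs) = fint B (OldF s) (map h xs)"
    if s: "s \<in> funs L0" and xs: "xs \<in> tuples (univ A) (fun_ar L0 s)" for s xs
  proof (cases "set xs \<subseteq> Mpart A")
    case True
    with xs have "xs \<in> tuples (Mpart A) (fun_ar L0 s)" by (simp add: tuples_def)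
    with iso s show ?thesis by (simp add: is_iso_def)
  next
    case False
    then have "fint A (OldF s) xs = hd xs" by (rule A(2)[OF s xs])
    moreover have "fint B (OldF s) (map h xs) = hd (map h xs)"
      using B(2)[OF s map_h[OF xs]] M_tuple[OF xs] False by blast
    moreover have "xs \<noteq> []" using False by auto
    ultimately show ?thesis by (simp add: hd_map)
  qed
  show "rint A (OldR R) xs \<longleftrightarrow> rint B (OldR R) (map h xs)"
    if R: "R \<in> rels L0" and xs: "xs \<in> tuples (univ A) (rel_ar L0 R)" for R xs
  proof (cases "set xs \<subseteq> Mpart A")
    case True
    with xs have "xs \<in> tuples (Mpart A) (rel_ar L0 R)" by (simp add: tuples_def)
    with iso R show ?thesis by (simp add: is_iso_def)
  next
    case False
    then show ?thesis using A(1)[OF R xs] B(1)[OF R map_h[OF xs]] M_tuple[OF xs] by blast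
  qed
qed

lemma is_iso_xlangI:
  assumes off: "trivial_off_domain L0 A" "trivial_off_domain L0 B"
    and bij: "bij_betw h (univ A) (univ B)" and iso: "is_iso L0 (Mstruct A) (Mstruct B) h"
    and V: "\<And>x. x \<in> univ A \<Longrightarrow> h x \<in> Vpart B \<longleftrightarrow> x \<in> Vpart A"
    and N: "\<And>x. x \<in> univ A \<Longrightarrow> h x \<in> Npart B \<longleftrightarrow> x \<in> Npart A"
    and tri: "\<And>x y. x \<in> Vpart A \<Longrightarrow> y \<in> Vpart A \<Longrightarrow> (h x, h y) \<in> tri B \<longleftrightarrow> (x, y) \<in> tri A"
    and f: "\<And>x y. x \<in> Vpart A \<Longrightarrow> y \<in> Vpart A \<Longrightarrow> x \<noteq> y \<Longrightarrow> ff B (h x) (h y) = h (ff A x y)"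
  shows "is_iso (xlang L0) A B h"
proof -
  note A = trivial_off_domainD[OF off(1)] and B = trivial_off_domainD[OF off(2)]
    and old = trivial_off_domain_iso_old_symbols[OF off bij iso]
  have hB: "h x \<in> univ B" if "x \<in> univ A" for x using bij that by (auto simp: bij_betw_def)
  have inj: "inj_on h (univ A)" using bij by (simp add: bij_betw_def)
  have "h (ff A x y) = ff B (h x) (h y)" if "x \<in> univ A" "y \<in> univ A" for x y
  proof (cases "x \<in> Vpart A \<and> y \<in> Vpart A \<and> x \<noteq> y")
    case True
    then show ?thesis using f by simp
  next
    case False
    then have "ff A x y = x" by (rule A(4)[OF that])
    moreover have "ff B (h x) (h y) = h x"
      using False V that by (intro B(4) hB) (auto simp: inj_on_eq_iff[OF inj])
    ultimately show ?thesis by simp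
  qed
  moreover have "rint A Tri_sym [x, y] \<longleftrightarrow> rint B Tri_sym [h x, h y]"
    if "x \<in> univ A" "y \<in> univ A" for x y
  proof -
    have "(x, y) \<in> tri A \<longleftrightarrow> (h x, h y) \<in> tri B"
      using tri[of x y] V[of x] V[of y] that by (auto simp: rel_on_def)
    with A(3)[OF that] B(3)[OF hB[OF that(1)] hB[OF that(2)]] show ?thesis by simp
  qed
  moreover have "rint A V_sym [x] \<longleftrightarrow> rint B V_sym [h x]" "rint A M_sym [x] \<longleftrightarrow> rint B M_sym [h x]"
    "rint A N_sym [x] \<longleftrightarrow> rint B N_sym [h x]" if "x \<in> univ A" for x
    using V[OF that] old(3)[OF that] N[OF that] hB[OF that] that
    by (simp_all add: Vpart_def Mpart_def Npart_def)
  ultimately show ?thesis using bij old(1,2) by (simp add: is_iso_xlang_iff)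
qed

section \<open>Transfer along local embeddings\<close>

lemma strict_linear_order_on_locally:
  fixes r :: "'a rel"
  assumes r: "r \<subseteq> X \<times> X"
    and local: "\<And>x y z. {x, y, z} \<subseteq> X \<Longrightarrow> \<exists>h Y (s :: 'b rel).
      strict_linear_order_on Y s \<and> {x, y, z} \<subseteq> h ` Y \<and> (\<forall>a\<in>Y. \<forall>b\<in>Y. (h a, h b) \<in> r \<longleftrightarrow> (a, b) \<in> s)"
  shows "strict_linear_order_on X r"
  unfolding strict_linear_order_on_def
proof (intro conjI)
  show "trans r"
  proof (rule transI)
    fix x y z assume xy: "(x, y) \<in> r" and yz: "(y, z) \<in> r"
    then have "{x, y, z} \<subseteq> X" using r by auto
    from local[OF this] xy yz show "(x, z) \<in> r"
      unfolding strict_linear_order_on_def by (auto dest: transD)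
  qed
  show "irrefl r"
  proof (rule irreflI)
    fix x
    show "(x, x) \<notin> r"
    proof
      assume xx: "(x, x) \<in> r"
      then have "{x, x, x} \<subseteq> X" using r by auto
      from local[OF this] xx show False
        unfolding strict_linear_order_on_def irrefl_def by auto
    qed
  qed
  show "total_on X r"
  proof (rule total_onI)
    fix x y assume "x \<in> X" "y \<in> X" "x \<noteq> y"
    then have "{x, y, y} \<subseteq> X" by simp
    from local[OF this] obtain h Y and s :: "'b rel" where "strict_linear_order_on Y s"
      and Y: "{x, y, y} \<subseteq> h ` Y" "\<forall>a\<in>Y. \<forall>b\<in>Y. (h a, h b) \<in> r \<longleftrightarrow> (a, b) \<in> s"
      by (elim exE conjE)
    then have "total_on Y s" by (simp add: strict_linear_order_on_def)
    moreover obtain a b where "a \<in> Y" "b \<in> Y" "x = h a" "y = h b" using Y(1) by auto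
    ultimately show "(x, y) \<in> r \<or> (y, x) \<in> r"
      using Y(2) \<open>x \<noteq> y\<close> by (auto simp: total_on_def)
  qed
qed

lemma embedding_less_M_refl:
  assumes "is_embedding (xlang L0) A B h" "lt \<in> rels L0" "rel_ar L0 lt = 2"
    and "x \<in> univ A" "y \<in> univ A"
    and "(x, y) \<in> (less_M lt A)\<^sup>="
  shows "(h x, h y) \<in> (less_M lt B)\<^sup>="
  using assms(6) embedding_less_M[OF assms(1-5)] by auto

text \<open>
  Every axiom of full value structures is a universal-existential condition with at most three
  universal quantifiers, so copies around all triples of elements suffice.
\<close>

locale locally_embedded_full_value_structure = full_value_structure lt A
  for lt :: 'r and A :: "('f, 'r, 'a) xstruct" +
  fixes L0 :: "('f, 'r) lang" and B :: "('f, 'r, 'b) xstruct"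
  assumes lt_binary: "lt \<in> rels L0" "rel_ar L0 lt = 2"
    and univ_B_nonempty: "univ B \<noteq> {}"
    and embedding_through: "{x, y, z} \<subseteq> univ B \<Longrightarrow>
      \<exists>h. is_embedding (xlang L0) A B h \<and> {x, y, z} \<subseteq> h ` univ A"
begin

lemma embedding_through_subset:
  assumes xyz: "{x, y, z} \<subseteq> Y" and Y: "Y \<subseteq> univ B"
    and image: "\<And>h. is_embedding (xlang L0) A B h \<Longrightarrow> h ` univ A \<inter> Y = h ` X"
  obtains h where "is_embedding (xlang L0) A B h" "{x, y, z} \<subseteq> h ` X"
proof -
  have "{x, y, z} \<subseteq> univ B" using xyz Y by (rule subset_trans)
  then obtain h where h: "is_embedding (xlang L0) A B h" "{x, y, z} \<subseteq> h ` univ A"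
    using embedding_through by blast
  have "{x, y, z} \<subseteq> h ` X" using Int_greatest[OF h(2) xyz] by (simp only: image[OF h(1)])
  with h(1) show ?thesis by (rule that)
qed

lemma embedding_through_V:
  assumes "{x, y, z} \<subseteq> Vpart B"
  obtains h where "is_embedding (xlang L0) A B h" "{x, y, z} \<subseteq> h ` Vpart A"
  using assms parts_subset_univ(1) embedding_image_parts(1) by (rule embedding_through_subset)

lemma embedding_through_M:
  assumes "{x, y, z} \<subseteq> Mpart B"
  obtains h where "is_embedding (xlang L0) A B h" "{x, y, z} \<subseteq> h ` Mpart A"
  using assms parts_subset_univ(2) embedding_image_parts(2) by (rule embedding_through_subset)

lemma strict_linear_order_on_copy:
  assumes Y: "Y \<subseteq> univ B" "s \<subseteq> Y \<times> Y"
    and image: "\<And>h. is_embedding (xlang L0) A B h \<Longrightarrow> h ` univ A \<inter> Y = h ` X"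
    and rel: "\<And>h a b. is_embedding (xlang L0) A B h \<Longrightarrow> a \<in> X \<Longrightarrow> b \<in> X \<Longrightarrow>
      (h a, h b) \<in> s \<longleftrightarrow> (a, b) \<in> r"
    and r: "strict_linear_order_on X r"
  shows "strict_linear_order_on Y s"
  using Y(2)
proof (rule strict_linear_order_on_locally)
  fix x y z assume "{x, y, z} \<subseteq> Y"
  then obtain h where h: "is_embedding (xlang L0) A B h" "{x, y, z} \<subseteq> h ` X"
    using Y(1) image by (rule embedding_through_subset)
  moreover have "\<forall>a\<in>X. \<forall>b\<in>X. (h a, h b) \<in> s \<longleftrightarrow> (a, b) \<in> r" using rel[OF h(1)] by simp
  ultimately show "\<exists>h (X :: 'a set) r. strict_linear_order_on X r \<and> {x, y, z} \<subseteq> h ` X \<and>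
      (\<forall>a\<in>X. \<forall>b\<in>X. (h a, h b) \<in> s \<longleftrightarrow> (a, b) \<in> r)"
    using r by blast
qed

lemma V_univ: "x \<in> Vpart A \<Longrightarrow> x \<in> univ A" and M_univ: "x \<in> Mpart A \<Longrightarrow> x \<in> univ A"
  using parts_subset_univ[of A] by auto

lemma V_linear_copy: "strict_linear_order_on (Vpart B) (tri B)"
  using parts_subset_univ(1) _ embedding_image_parts(1) embedding_tri V_linear
  by (rule strict_linear_order_on_copy) (auto simp: rel_on_def V_univ)

lemma M_linear_copy: "strict_linear_order_on (Mpart B) (less_M lt B)"
  using parts_subset_univ(2) _ embedding_image_parts(2) embedding_less_M[OF _ lt_binary] M_linear
  by (rule strict_linear_order_on_copy) (auto simp: rel_on_def M_univ)

lemma M_no_greatest_copy: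
  assumes "m \<in> Mpart B"
  shows "\<exists>m'\<in>Mpart B. (m, m') \<in> less_M lt B"
proof -
  have "{m, m, m} \<subseteq> Mpart B" using assms by simp
  then obtain h a where h: "is_embedding (xlang L0) A B h" and a: "a \<in> Mpart A" "m = h a"
    by (rule embedding_through_M) auto
  obtain b where b: "b \<in> Mpart A" "(a, b) \<in> less_M lt A" using M_no_greatest[OF a(1)] by blast
  have "(m, h b) \<in> less_M lt B" using embedding_less_M[OF h lt_binary] a b M_univ by simp
  moreover have "h b \<in> Mpart B" using embedding_parts(2)[OF h] b(1) M_univ by simp
  ultimately show ?thesis by blast
qed

lemma value_in_M_copy:
  assumes "(x, y) \<in> tri B"
  shows "ff B x y \<in> Mpart B"
proof -
  have "{x, y, y} \<subseteq> Vpart B" using assms by (auto simp: rel_on_def)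
  then obtain h a b where h: "is_embedding (xlang L0) A B h"
    and ab: "a \<in> Vpart A" "b \<in> Vpart A" "x = h a" "y = h b"
    by (rule embedding_through_V) auto
  have "(a, b) \<in> tri A" using assms embedding_tri[OF h] ab V_univ by simp
  then have "ff A a b \<in> Mpart A" by (rule value_in_M)
  then show ?thesis
    using embedding_value[OF h] embedding_parts(2)[OF h] ab V_univ M_univ by simp
qed

lemma value_triangle_copy:
  assumes xy: "(x, y) \<in> tri B" and yz: "(y, z) \<in> tri B"
  shows "(ff B x z, ff B y z) \<in> (less_M lt B)\<^sup>=" "(ff B x z, ff B x y) \<in> (less_M lt B)\<^sup>="
proof -
  have "{x, y, z} \<subseteq> Vpart B" using assms by (auto simp: rel_on_def)
  then obtain h a b c where h: "is_embedding (xlang L0) A B h"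
    and V: "a \<in> Vpart A" "b \<in> Vpart A" "c \<in> Vpart A" and eq: "x = h a" "y = h b" "z = h c"
    by (rule embedding_through_V) auto
  note univ = V[THEN V_univ]
  have tri: "(a, b) \<in> tri A" "(b, c) \<in> tri A"
    using xy yz embedding_tri[OF h] univ by (simp_all add: eq)
  then have "(a, c) \<in> tri A"
    using V_linear by (auto simp: strict_linear_order_on_def dest: transD)
  note M = value_in_M[OF tri(1), THEN M_univ] value_in_M[OF tri(2), THEN M_univ]
    value_in_M[OF this, THEN M_univ]
  show "(ff B x z, ff B y z) \<in> (less_M lt B)\<^sup>="
    using embedding_less_M_refl[OF h lt_binary M(3,2) value_mono[OF tri]]
    by (simp only: eq embedding_value[OF h] univ)
  show "(ff B x z, ff B x y) \<in> (less_M lt B)\<^sup>="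
    using embedding_less_M_refl[OF h lt_binary M(3,1) value_antimono[OF tri]]
    by (simp only: eq embedding_value[OF h] univ)
qed

lemma value_surjective_copy:
  assumes "x \<in> Vpart B" "m \<in> Mpart B"
  shows "\<exists>y. (y, x) \<in> tri B \<and> ff B y x = m" "\<exists>y. (x, y) \<in> tri B \<and> ff B x y = m"
proof -
  have "{x, m, m} \<subseteq> univ B" using assms parts_subset_univ[of B] by auto
  from embedding_through[OF this] obtain h where h: "is_embedding (xlang L0) A B h"
    and "{x, m, m} \<subseteq> h ` univ A"
    by blast
  then obtain a c where ac: "a \<in> univ A" "c \<in> univ A" and eq: "x = h a" "m = h c" by auto
  have a: "a \<in> Vpart A" and c: "c \<in> Mpart A" using assms ac embedding_parts[OF h] by (auto simp: eq)
  obtain b where b: "(b, a) \<in> tri A" "ff A b a = c" using value_below[OF a c] by blast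
  obtain d where d: "(a, d) \<in> tri A" "ff A a d = c" using value_above[OF a c] by blast
  have "b \<in> univ A" "d \<in> univ A" using b(1) d(1) V_univ by (auto simp: rel_on_def)
  with ac b have "(h b, x) \<in> tri B \<and> ff B (h b) x = m"
    by (simp only: eq embedding_tri[OF h] embedding_value[OF h] simp_thms)
  then show "\<exists>y. (y, x) \<in> tri B \<and> ff B y x = m" ..
  from \<open>d \<in> univ A\<close> ac d have "(x, h d) \<in> tri B \<and> ff B x (h d) = m"
    by (simp only: eq embedding_tri[OF h] embedding_value[OF h] simp_thms)
  then show "\<exists>y. (x, y) \<in> tri B \<and> ff B x y = m" ..
qed

theorem full_value_structure_copy: "full_value_structure lt B"
proof
  obtain u where "u \<in> univ B" using univ_B_nonempty by blast
  then obtain h where h: "is_embedding (xlang L0) A B h" using embedding_through[of u u u] by blast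
  show "Vpart B \<noteq> {}" using V_nonempty embedding_image_parts(1)[OF h] by blast
qed (fact V_linear_copy M_linear_copy M_no_greatest_copy value_in_M_copy value_triangle_copy
    value_surjective_copy)+

end

section \<open>The limit realizes every value on both sides of a point\<close>

definition two_point_extension ::
  "('f, 'r, 'a) struct \<Rightarrow> 'a \<Rightarrow> 'a \<Rightarrow> bool \<Rightarrow> 'a \<Rightarrow> ('f, 'r, 'a) xstruct" where
  "two_point_extension C a b p m = \<lparr>
     univ = {a, b} \<union> univ C,
     fint = case_xfun
       (\<lambda>s xs. if set xs \<subseteq> univ C then fint C s xs else hd xs)
       (\<lambda>xs. if set xs = {a, b} then m else hd xs),
     rint = case_xrel
       (\<lambda>R xs. set xs \<subseteq> univ C \<and> rint C R xs)
       (\<lambda>xs. set xs \<subseteq> {a, b}) (\<lambda>xs. set xs \<subseteq> univ C) (\<lambda>xs. set xs \<subseteq> {a, b} \<and> p) (\<lambda>xs. xs = [a, b])\<rparr>"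

lemma two_point_extension_simps [simp]:
  "univ (two_point_extension C a b p m) = {a, b} \<union> univ C"
  "fint (two_point_extension C a b p m) (OldF s) xs =
     (if set xs \<subseteq> univ C then fint C s xs else hd xs)"
  "fint (two_point_extension C a b p m) F_sym xs = (if set xs = {a, b} then m else hd xs)"
  "rint (two_point_extension C a b p m) (OldR R) xs \<longleftrightarrow> set xs \<subseteq> univ C \<and> rint C R xs"
  "rint (two_point_extension C a b p m) Tri_sym xs \<longleftrightarrow> xs = [a, b]"
  "Vpart (two_point_extension C a b p m) = {a, b}"
  "Mpart (two_point_extension C a b p m) = univ C"
  "Npart (two_point_extension C a b p m) = (if p then {a, b} else {})"
  by (auto simp: two_point_extension_def Vpart_def Mpart_def Npart_def)

lemma tri_two_point_extension [simp]:
  "rel_on (two_point_extension C a b p m) Tri_sym {a, b} = {(a, b)}"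
  by (auto simp: rel_on_def)

lemma is_iso_Mstruct_two_point_extension: "is_iso L0 C (Mstruct (two_point_extension C a b p m)) id"
  by (simp add: is_iso_def tuples_def)

lemma closed_under_two_point_extension:
  assumes C: "is_struct L0 C" and m: "m \<in> univ C"
  shows "closed_under (xlang L0) (two_point_extension C a b p m) ({a, b} \<union> univ C)"
proof -
  let ?B = "two_point_extension C a b p m" and ?U = "{a, b} \<union> univ C"
  have "fint ?B (OldF s) xs \<in> ?U"
    if s: "s \<in> funs L0" and xs: "xs \<in> tuples ?U (fun_ar L0 s)" for s xs
  proof (cases "set xs \<subseteq> univ C")
    case True
    then have "xs \<in> tuples (univ C) (fun_ar L0 s)" using xs by (simp add: tuples_def)
    then show ?thesis using C s True by (simp add: is_struct_def closed_under_def)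
  next
    case False
    then have "hd xs \<in> set xs" by (cases xs) auto
    then show ?thesis using False xs by (auto simp: tuples_def)
  qed
  moreover have "fint ?B F_sym xs \<in> ?U" if "xs \<in> tuples ?U 2" for xs
    using that m by (auto simp: tuples_2)
  ultimately show ?thesis unfolding closed_under_def ball_funs_xlang xlang_simps by blast
qed

lemma in_K_two_point_extension:
  assumes C: "is_struct L0 C" "countable (univ C)" "isomorphic L0 C M"
    and ab: "a \<noteq> b" "a \<notin> univ C" "b \<notin> univ C" and m: "m \<in> univ C"
  shows "in_K L0 lt M (two_point_extension C a b p m)"
proof -
  let ?B = "two_point_extension C a b p m"
  have "is_struct (xlang L0) ?B"
    using closed_under_two_point_extension[OF C(1) m] by (simp add: is_struct_def)
  moreover have "trivial_off_domain L0 ?B"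
    unfolding trivial_off_domain_def
  proof (intro conjI ballI impI)
    show "ff ?B x y = x" if "\<not> (x \<in> Vpart ?B \<and> y \<in> Vpart ?B \<and> x \<noteq> y)" for x y
      using that ab(1) by (auto simp: doubleton_eq_iff)
  qed auto
  moreover have "is_struct L0 (Mstruct ?B)"
    using is_iso_Mstruct_two_point_extension C(1) by (rule is_struct_iso)
  moreover have "isomorphic L0 C (Mstruct ?B)"
    unfolding isomorphic_def by (intro exI) (rule is_iso_Mstruct_two_point_extension)
  then have "isomorphic L0 (Mstruct ?B) M"
    using isomorphic_sym[OF _ C(1)] isomorphic_trans C(3) by blast
  moreover have "strict_linear_order_on (Vpart ?B) (tri ?B)"
    using ab(1) by (auto simp: strict_linear_order_on_def trans_def irrefl_def total_on_def)
  ultimately show ?thesis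
    unfolding in_K_def using C(2) ab m by auto
qed

lemma in_K_single_V_point_iso:
  assumes A: "in_K L0 lt M A" and B: "in_K L0 lt M B"
    and V: "Vpart A = {a}" "Vpart B = {b}" and N: "a \<in> Npart A \<longleftrightarrow> b \<in> Npart B"
    and j: "is_iso L0 (Mstruct A) (Mstruct B) j"
  shows "is_iso (xlang L0) A B (j(a := b))"
proof (rule is_iso_xlangI)
  let ?h = "j(a := b)"
  show "trivial_off_domain L0 A" "trivial_off_domain L0 B" using A B by (simp_all add: in_K_def)
  have univ: "univ A = insert a (Mpart A)" "univ B = insert b (Mpart B)"
    and a: "a \<notin> Mpart A" and b: "b \<notin> Mpart B"
    using A B V by (auto simp: in_K_def)
  have "is_struct L0 (Mstruct A)" using A by (simp add: in_K_def)
  then show h: "is_iso L0 (Mstruct A) (Mstruct B) ?h"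
    by (rule is_iso_cong[OF j, rotated]) (use a in auto)
  then have "bij_betw ?h (Mpart A) (Mpart B)" by (simp add: is_iso_def)
  then show "bij_betw ?h (univ A) (univ B)"
    using notIn_Un_bij_betw[of a "Mpart A" ?h "Mpart B"] a b by (simp add: univ)
  have jM: "j x \<in> Mpart B" "j x \<noteq> b" if "x \<in> Mpart A" for x
    using j b that by (auto simp: is_iso_iff_embedding)
  show "?h x \<in> Vpart B \<longleftrightarrow> x \<in> Vpart A" if "x \<in> univ A" for x
    using that V jM by (cases "x = a") (auto simp: univ)
  have "Npart A \<subseteq> {a}" "Npart B \<subseteq> {b}" using A B V by (auto simp: in_K_def)
  then show "?h x \<in> Npart B \<longleftrightarrow> x \<in> Npart A" if "x \<in> univ A" for x
    using that N jM by (cases "x = a") (auto simp: univ)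
  have "irrefl (tri A)" "irrefl (tri B)"
    using A B by (simp_all add: in_K_def strict_linear_order_on_def)
  then show "(?h x, ?h y) \<in> tri B \<longleftrightarrow> (x, y) \<in> tri A" if "x \<in> Vpart A" "y \<in> Vpart A" for x y
    using that by (simp add: V irrefl_def)
qed (simp add: V)

lemma in_K_closed_under_V_point:
  assumes A: "in_K L0 lt M A" and a: "a \<in> Vpart A"
  shows "closed_under (xlang L0) A (insert a (Mpart A))"
proof -
  let ?X = "insert a (Mpart A)"
  have X: "?X \<subseteq> univ A" using a parts_subset_univ[of A] by auto
  have off: "trivial_off_domain L0 A" and disjoint: "Vpart A \<inter> Mpart A = {}"
    using A by (simp_all add: in_K_def)
  have "fint A (OldF s) xs \<in> ?X" if s: "s \<in> funs L0" and xs: "xs \<in> tuples ?X (fun_ar L0 s)" for s xs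
  proof (cases "set xs \<subseteq> Mpart A")
    case True
    with xs have "xs \<in> tuples (Mpart A) (fun_ar L0 s)" by (simp add: tuples_def)
    moreover have "closed_under L0 (Mstruct A) (Mpart A)"
      using A by (simp add: in_K_def is_struct_def)
    ultimately show ?thesis using s by (simp add: closed_under_def)
  next
    case False
    then have "fint A (OldF s) xs = hd xs"
      using trivial_off_domainD(2)[OF off s] xs tuples_mono[OF X] by blast
    moreover have "hd xs \<in> set xs" using False by (cases xs) auto
    ultimately show ?thesis using xs by (auto simp: tuples_def)
  qed
  moreover have "ff A x y = x" if "x \<in> ?X" "y \<in> ?X" for x y
  proof (rule trivial_off_domainD(4)[OF off])
    show "\<not> (x \<in> Vpart A \<and> y \<in> Vpart A \<and> x \<noteq> y)" using that disjoint by blast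
  qed (use that X in blast)+
  ultimately show ?thesis unfolding closed_under_def ball_funs_xlang by (auto simp: tuples_2)
qed

lemma fin_gen_over_subset:
  assumes "fin_gen_over L A Y X" "is_struct L A" "Y \<subseteq> univ A"
  shows "Y \<subseteq> X" "X \<subseteq> univ A"
  using assms by (auto simp: fin_gen_over_def generated_def is_struct_def)

lemma fin_gen_over_insert:
  assumes "closed_under L A (insert a Y)" "insert a Y \<subseteq> univ A"
  shows "fin_gen_over L A Y (insert a Y)"
proof -
  have "generated L A {a} \<subseteq> insert a Y"
    unfolding generated_def using assms by (intro Inter_lower) auto
  moreover have "a \<in> generated L A {a}" by (auto simp: generated_def)
  ultimately have "insert a Y = generated L A {a} \<union> Y" by blast
  then show ?thesis using assms(2) unfolding fin_gen_over_def by blast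
qed

lemma fraisse_fin_gen:
  assumes F: "fraisse_limit L0 lt M F" and X: "fin_gen_over (xlang L0) F (Mpart F) X"
  shows "Mpart F \<subseteq> X" "X \<subseteq> univ F" "in_K L0 lt M (restr F X)"
proof -
  have "is_struct (xlang L0) F" using F by (simp add: fraisse_limit_def)
  with X show "Mpart F \<subseteq> X" "X \<subseteq> univ F"
    using parts_subset_univ(2) by (rule fin_gen_over_subset)+
  show "in_K L0 lt M (restr F X)" using F X by (simp add: fraisse_limit_def)
qed

lemma fraisse_finite_subset:
  assumes F: "fraisse_limit L0 lt M F" and Y: "Y \<subseteq> univ F" "finite Y"
  obtains X where "Y \<subseteq> X" "Mpart F \<subseteq> X" "X \<subseteq> univ F" "in_K L0 lt M (restr F X)"
proof -
  let ?X = "generated (xlang L0) F Y \<union> Mpart F"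
  have "fin_gen_over (xlang L0) F (Mpart F) ?X" using Y by (auto simp: fin_gen_over_def)
  note X = fraisse_fin_gen[OF F this]
  have "Y \<subseteq> ?X" by (auto simp: generated_def)
  then show ?thesis using X by (rule that)
qed

lemma fraisse_V_point:
  assumes F: "fraisse_limit L0 lt M F" and x: "x \<in> Vpart F"
  shows "fin_gen_over (xlang L0) F (Mpart F) (insert x (Mpart F))" "x \<notin> Mpart F"
    "Vpart (restr F (insert x (Mpart F))) = {x}"
proof -
  have "{x} \<subseteq> univ F" using x parts_subset_univ(1)[of F] by blast
  then obtain X where X: "{x} \<subseteq> X" "Mpart F \<subseteq> X" "X \<subseteq> univ F"
    and K: "in_K L0 lt M (restr F X)"
    by (rule fraisse_finite_subset[OF F]) simp
  have parts: "Mpart (restr F X) = Mpart F" "x \<in> Vpart (restr F X)"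
    using X x by (auto simp: parts_restr)
  have sub: "insert x (Mpart F) \<subseteq> univ F" using X by blast
  have "closed_under (xlang L0) F (insert x (Mpart F))"
    using in_K_closed_under_V_point[OF K parts(2)] by (simp add: parts(1))
  then show "fin_gen_over (xlang L0) F (Mpart F) (insert x (Mpart F))"
    using sub by (rule fin_gen_over_insert)
  have "Vpart F \<inter> X \<inter> Mpart F = {}" using K X by (simp add: in_K_def parts_restr Int_absorb2)
  then show "x \<notin> Mpart F" "Vpart (restr F (insert x (Mpart F))) = {x}"
    using x X parts_restr(1)[OF sub] by blast+
qed

lemma fraisse_homogeneous_V_points:
  assumes F: "fraisse_limit L0 lt M F" and V: "x \<in> Vpart F" "y \<in> Vpart F"
    and N: "x \<in> Npart F \<longleftrightarrow> y \<in> Npart F" and j: "is_iso L0 (Mstruct F) (Mstruct F) j"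
  obtains g where "is_iso (xlang L0) F F g" "g x = y" "\<And>v. v \<in> Mpart F \<Longrightarrow> g v = j v"
proof -
  let ?X = "insert x (Mpart F)" and ?Y = "insert y (Mpart F)"
  note x = fraisse_V_point[OF F V(1)] and y = fraisse_V_point[OF F V(2)]
  note X = fraisse_fin_gen[OF F x(1)] and Y = fraisse_fin_gen[OF F y(1)]
  have "is_iso (xlang L0) (restr F ?X) (restr F ?Y) (j(x := y))"
    using X(3) Y(3) x(3) y(3)
  proof (rule in_K_single_V_point_iso)
    show "x \<in> Npart (restr F ?X) \<longleftrightarrow> y \<in> Npart (restr F ?Y)"
      using N by (simp add: parts_restr(3)[OF X(2)] parts_restr(3)[OF Y(2)])
    show "is_iso L0 (Mstruct (restr F ?X)) (Mstruct (restr F ?Y)) j"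
      using j by (simp add: Mstruct_restr[OF X(1,2)] Mstruct_restr[OF Y(1,2)])
  qed
  then obtain g where g: "is_iso (xlang L0) F F g" "\<forall>v\<in>?X. g v = (j(x := y)) v"
    using F x(1) y(1) unfolding fraisse_limit_def by blast
  show ?thesis
  proof (rule that[OF g(1)])
    show "g x = y" using g(2) by simp
    show "g v = j v" if "v \<in> Mpart F" for v using g(2) x(2) that by auto
  qed
qed

lemma fraisse_embeds_K:
  fixes B :: "('f, 'r, nat) xstruct"
  assumes F: "fraisse_limit L0 lt M F" and B: "in_K L0 lt M B"
  obtains k where "is_embedding (xlang L0) B F k" "is_iso L0 (Mstruct B) (Mstruct F) k"
proof -
  obtain X h where "fin_gen_over (xlang L0) F (Mpart F) X"
    and h: "is_iso (xlang L0) (restr F X) B h"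
    using F B unfolding fraisse_limit_def isomorphic_def by blast
  note X = fraisse_fin_gen[OF F this(1)]
  have k: "is_iso (xlang L0) B (restr F X) (inv_into X h)"
    using is_iso_inv[OF h] X(3) by (simp add: in_K_def)
  show ?thesis
  proof
    show "is_embedding (xlang L0) B F (inv_into X h)" using k X(2) by (rule iso_restr_imp_embedding)
    show "is_iso L0 (Mstruct B) (Mstruct F) (inv_into X h)"
      using is_iso_Mstruct[OF k] by (simp add: Mstruct_restr[OF X(1,2)])
  qed
qed

lemma fraisse_two_V_points:
  assumes F: "fraisse_limit L0 lt M F" and m: "m \<in> Mpart F"
  obtains u v j where "(u, v) \<in> tri F" "u \<in> Npart F \<longleftrightarrow> p" "v \<in> Npart F \<longleftrightarrow> p"
    "is_iso L0 (Mstruct F) (Mstruct F) j" "ff F u v = j m"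
proof -
  have struct: "is_struct L0 (Mstruct F)" and iso: "isomorphic L0 (Mstruct F) M"
    and "countable (univ F)"
    using F by (simp_all add: fraisse_limit_def)
  then have countable: "countable (Mpart F)" by (intro countable_subset[OF parts_subset_univ(2)])
  define c where "c v = to_nat_on (Mpart F) v + 2" for v
  let ?C = "image_struct c (Mstruct F)"
  let ?B = "two_point_extension ?C 0 1 p (c m)"
  have univ_C: "univ ?C = c ` Mpart F" by (simp add: image_struct_def)
  have "inj_on c (Mpart F)" using inj_on_to_nat_on[OF countable] by (auto simp: c_def inj_on_def)
  then have c: "is_iso L0 (Mstruct F) ?C c" by (intro is_iso_image_struct) simp
  then have "isomorphic L0 ?C (Mstruct F)"
    using isomorphic_sym[OF _ struct] by (auto simp: isomorphic_def)
  then have "isomorphic L0 ?C M" using iso by (rule isomorphic_trans)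
  moreover have "is_struct L0 ?C" using c struct by (rule is_struct_iso)
  ultimately have "in_K L0 lt M ?B"
    using countable m by (intro in_K_two_point_extension) (auto simp: univ_C c_def)
  then obtain k where emb: "is_embedding (xlang L0) ?B F k"
    and k: "is_iso L0 (Mstruct ?B) (Mstruct F) k"
    by (rule fraisse_embeds_K[OF F])
  have "is_iso L0 (Mstruct F) (Mstruct F) (k \<circ> (id \<circ> c))"
    using c is_iso_Mstruct_two_point_extension k by (intro is_iso_comp)
  then have "is_iso L0 (Mstruct F) (Mstruct F) (k \<circ> c)" by simp
  moreover have "(k 0, k 1) \<in> tri F" using embedding_tri[OF emb, of 0 1] by simp
  moreover have "k 0 \<in> Npart F \<longleftrightarrow> p" "k 1 \<in> Npart F \<longleftrightarrow> p"
    using embedding_parts(3)[OF emb, of 0] embedding_parts(3)[OF emb, of 1] by simp_all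
  moreover have "ff F (k 0) (k 1) = (k \<circ> c) m" using embedding_value[OF emb, of 0 1] by simp
  ultimately show ?thesis using that by blast
qed

lemma automorphism_pull_back_value:
  assumes g: "is_iso (xlang L0) F F g" and F: "is_struct (xlang L0) F"
    and uv: "(u, v) \<in> tri F" "ff F u v = g m" and m: "m \<in> univ F"
  obtains x y where "(x, y) \<in> tri F" "g x = u" "g y = v" "ff F x y = m"
proof -
  have emb: "is_embedding (xlang L0) F F g" and surj: "g ` univ F = univ F"
    using g by (simp_all add: is_iso_iff_embedding)
  have "u \<in> univ F" "v \<in> univ F" using uv(1) parts_subset_univ(1)[of F] by (auto simp: rel_on_def)
  then obtain x y where xy: "x \<in> univ F" "y \<in> univ F" "g x = u" "g y = v"
    using surj by (metis imageE)
  have "g (ff F x y) = g m" using embedding_value[OF emb xy(1,2)] xy uv(2) by simp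
  moreover have "ff F x y \<in> univ F"
    using F xy by (simp add: is_struct_def closed_under_def ball_funs_xlang tuples_2)
  ultimately have "ff F x y = m" using emb m by (auto simp: is_embedding_def dest: inj_onD)
  moreover have "(x, y) \<in> tri F" using embedding_tri[OF emb xy(1,2)] xy uv(1) by simp
  ultimately show ?thesis using xy that by blast
qed

lemma fraisse_value_surjective:
  assumes F: "fraisse_limit L0 lt M F" and x: "x \<in> Vpart F" and m: "m \<in> Mpart F"
  shows "\<exists>y. (y, x) \<in> tri F \<and> ff F y x = m" and "\<exists>y. (x, y) \<in> tri F \<and> ff F x y = m"
proof -
  have struct: "is_struct (xlang L0) F" using F by (simp add: fraisse_limit_def)
  obtain u v j where uv: "(u, v) \<in> tri F"
    and N: "u \<in> Npart F \<longleftrightarrow> x \<in> Npart F" "v \<in> Npart F \<longleftrightarrow> x \<in> Npart F"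
    and j: "is_iso L0 (Mstruct F) (Mstruct F) j" and uv_value: "ff F u v = j m"
    using fraisse_two_V_points[OF F m] .
  have V: "u \<in> Vpart F" "v \<in> Vpart F" using uv by (simp_all add: rel_on_def)
  have univ: "x \<in> univ F" "m \<in> univ F" using x m parts_subset_univ[of F] by auto
  have pull_back: "\<exists>y z. (y, z) \<in> tri F \<and> ff F y z = m \<and> (w = v \<longrightarrow> z = x) \<and> (w = u \<longrightarrow> y = x)"
    if w: "w \<in> Vpart F" "x \<in> Npart F \<longleftrightarrow> w \<in> Npart F" for w
  proof -
    obtain g where g: "is_iso (xlang L0) F F g" "g x = w" "\<And>v. v \<in> Mpart F \<Longrightarrow> g v = j v"
      using fraisse_homogeneous_V_points[OF F x w j] by blast
    have "ff F u v = g m" using uv_value g(3)[OF m] by simp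
    then obtain y z where yz: "(y, z) \<in> tri F" "g y = u" "g z = v" "ff F y z = m"
      using automorphism_pull_back_value[OF g(1) struct uv _ univ(2)] by blast
    have "inj_on g (univ F)" using g(1) by (simp add: is_iso_def bij_betw_def)
    moreover have "y \<in> univ F" "z \<in> univ F"
      using yz(1) parts_subset_univ(1)[of F] by (auto simp: rel_on_def)
    ultimately show ?thesis using yz g(2) univ(1) by (metis inj_onD)
  qed
  show "\<exists>y. (y, x) \<in> tri F \<and> ff F y x = m" using pull_back[OF V(2)] N(2) by blast
  show "\<exists>y. (x, y) \<in> tri F \<and> ff F x y = m" using pull_back[OF V(1)] N(1) by blast
qed

lemma fraisse_V_linear:
  fixes F :: "('f, 'r, 'a) xstruct"
  assumes F: "fraisse_limit L0 lt M F"
  shows "strict_linear_order_on (Vpart F) (tri F)"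
proof (rule strict_linear_order_on_locally)
  show "tri F \<subseteq> Vpart F \<times> Vpart F" by (auto simp: rel_on_def)
  fix x y z assume V: "{x, y, z} \<subseteq> Vpart F"
  then have "{x, y, z} \<subseteq> univ F" using parts_subset_univ(1) by (rule subset_trans)
  then obtain X where X: "{x, y, z} \<subseteq> X" "Mpart F \<subseteq> X" "X \<subseteq> univ F" "in_K L0 lt M (restr F X)"
    by (rule fraisse_finite_subset[OF F]) simp
  have "strict_linear_order_on (Vpart (restr F X)) (tri (restr F X))"
    using X(4) by (simp add: in_K_def)
  moreover have "{x, y, z} \<subseteq> id ` Vpart (restr F X)" using V X by (simp add: parts_restr)
  moreover have "\<forall>a\<in>Vpart (restr F X). \<forall>b\<in>Vpart (restr F X).
      (id a, id b) \<in> tri F \<longleftrightarrow> (a, b) \<in> tri (restr F X)"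
    using X(3) by (simp add: parts_restr rel_on_def)
  ultimately show "\<exists>h (Y :: 'a set) s. strict_linear_order_on Y s \<and> {x, y, z} \<subseteq> h ` Y \<and>
      (\<forall>a\<in>Y. \<forall>b\<in>Y. (h a, h b) \<in> tri F \<longleftrightarrow> (a, b) \<in> s)"
    by blast
qed

lemma fraisse_value_in_M:
  assumes F: "fraisse_limit L0 lt M F" and xy: "(x, y) \<in> tri F"
  shows "ff F x y \<in> Mpart F"
proof -
  have V: "{x, y} \<subseteq> Vpart F" using xy by (auto simp: rel_on_def)
  then have "{x, y} \<subseteq> univ F" using parts_subset_univ(1) by (rule subset_trans)
  then obtain X where X: "{x, y} \<subseteq> X" "Mpart F \<subseteq> X" "X \<subseteq> univ F"
    and K: "in_K L0 lt M (restr F X)"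
    by (rule fraisse_finite_subset[OF F]) simp
  have "x \<noteq> y" using xy fraisse_V_linear[OF F] by (auto simp: strict_linear_order_on_def irrefl_def)
  then show ?thesis using K V X by (simp add: in_K_def parts_restr)
qed

lemma fraisse_value_triangle:
  assumes F: "fraisse_limit L0 lt M F" and xy: "(x, y) \<in> tri F" and yz: "(y, z) \<in> tri F"
  shows "(ff F x z, ff F y z) \<in> (less_M lt F)\<^sup>=" "(ff F x z, ff F x y) \<in> (less_M lt F)\<^sup>="
proof -
  have "{x, y, z} \<subseteq> Vpart F" using xy yz by (auto simp: rel_on_def)
  then have "{x, y, z} \<subseteq> univ F" using parts_subset_univ(1) by (rule subset_trans)
  then obtain X where X: "{x, y, z} \<subseteq> X" "Mpart F \<subseteq> X" "X \<subseteq> univ F"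
    and K: "in_K L0 lt M (restr F X)"
    by (rule fraisse_finite_subset[OF F]) simp
  have M: "Mpart (restr F X) = Mpart F" using X by (simp add: parts_restr Int_absorb2)
  have "(x, y) \<in> tri (restr F X)" "(y, z) \<in> tri (restr F X)"
    using xy yz X by (auto simp: rel_on_def parts_restr)
  then have "(ff F x y = ff F x z \<and> ff F x z = ff F y z) \<or>
      (ff F x y = ff F x z \<and> (ff F x z, ff F y z) \<in> less_M lt F) \<or>
      (ff F x z = ff F y z \<and> (ff F y z, ff F x y) \<in> less_M lt F)"
    using K unfolding in_K_def fint_restr rel_on_restr M by blast
  then show "(ff F x z, ff F y z) \<in> (less_M lt F)\<^sup>=" "(ff F x z, ff F x y) \<in> (less_M lt F)\<^sup>="
    by auto
qed

lemma fraisse_M_linear_no_greatest: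
  fixes M :: "('f, 'r, 'm) struct"
  assumes lt: "lt \<in> rels L0" "rel_ar L0 lt = 2"
    and lin: "strict_linear_order_on (univ M) (rel_on M lt (univ M))"
    and no_greatest: "\<forall>a\<in>univ M. \<exists>b\<in>univ M. (a, b) \<in> rel_on M lt (univ M)"
    and F: "fraisse_limit L0 lt M F"
  shows "strict_linear_order_on (Mpart F) (less_M lt F)"
    and "\<forall>m\<in>Mpart F. \<exists>m'\<in>Mpart F. (m, m') \<in> less_M lt F"
proof -
  have "isomorphic L0 M (Mstruct F)" using F isomorphic_sym by (auto simp: fraisse_limit_def)
  then obtain i where "is_iso L0 M (Mstruct F) i" by (auto simp: isomorphic_def)
  then have i: "is_embedding L0 M (Mstruct F) i" and im: "i ` univ M = Mpart F"
    by (simp_all add: is_iso_iff_embedding)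
  have less: "(i a, i b) \<in> less_M lt F \<longleftrightarrow> (a, b) \<in> rel_on M lt (univ M)"
    if "a \<in> univ M" "b \<in> univ M" for a b
    using that embedding_binary_rel[OF i lt] by (auto simp: rel_on_def simp flip: im)
  show "strict_linear_order_on (Mpart F) (less_M lt F)"
  proof (rule strict_linear_order_on_locally)
    show "less_M lt F \<subseteq> Mpart F \<times> Mpart F" by (auto simp: rel_on_def)
    show "\<exists>h (Y :: 'm set) s. strict_linear_order_on Y s \<and> {x, y, z} \<subseteq> h ` Y \<and>
        (\<forall>a\<in>Y. \<forall>b\<in>Y. (h a, h b) \<in> less_M lt F \<longleftrightarrow> (a, b) \<in> s)" if "{x, y, z} \<subseteq> Mpart F" for x y z
      using that lin less unfolding im[symmetric] by blast
  qed
  show "\<forall>m\<in>Mpart F. \<exists>m'\<in>Mpart F. (m, m') \<in> less_M lt F"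
    using no_greatest less by (auto simp flip: im)
qed

lemma fraisse_full_value_structure:
  assumes lt: "lt \<in> rels L0" "rel_ar L0 lt = 2"
    and lin: "strict_linear_order_on (univ M) (rel_on M lt (univ M))"
    and no_greatest: "\<forall>a\<in>univ M. \<exists>b\<in>univ M. (a, b) \<in> rel_on M lt (univ M)"
    and F: "fraisse_limit L0 lt M F"
  shows "full_value_structure lt F"
proof
  have "Mpart F \<noteq> {}" using F by (simp add: fraisse_limit_def is_struct_def)
  then obtain m where "m \<in> Mpart F" by blast
  then obtain u v where "(u, v) \<in> tri F" by (rule fraisse_two_V_points[OF F])
  then show "Vpart F \<noteq> {}" by (auto simp: rel_on_def)
  show "strict_linear_order_on (Vpart F) (tri F)" by (rule fraisse_V_linear[OF F])
  note M = fraisse_M_linear_no_greatest[OF lt lin no_greatest F]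
  show "strict_linear_order_on (Mpart F) (less_M lt F)" by (rule M)
  show "\<exists>m'\<in>Mpart F. (m, m') \<in> less_M lt F" if "m \<in> Mpart F" for m using M(2) that ..
  show "\<exists>y. (y, x) \<in> tri F \<and> ff F y x = m" "\<exists>y. (x, y) \<in> tri F \<and> ff F x y = m"
    if "x \<in> Vpart F" "m \<in> Mpart F" for x m
    using fraisse_value_surjective[OF F that] .
qed (fact fraisse_value_in_M[OF F] fraisse_value_triangle[OF F])+

lemma scott_model_full_value_structure:
  assumes L0: "countable_lang L0" and lt: "lt \<in> rels L0" "rel_ar L0 lt = 2"
    and F: "full_value_structure lt F" and scott: "scott_sentence (xlang L0) F \<phi>"
    and G: "model_of (xlang L0) \<phi> G"
  shows "full_value_structure lt G"
proof -
  interpret full_value_structure lt F by (rule F)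
  interpret locally_embedded_full_value_structure lt F L0 G
  proof
    show "lt \<in> rels L0" "rel_ar L0 lt = 2" by (rule lt)+
    show "univ G \<noteq> {}" using G by (simp add: model_of_def is_struct_def)
    show "\<exists>h. is_embedding (xlang L0) F G h \<and> {x, y, z} \<subseteq> h ` univ F"
      if "{x, y, z} \<subseteq> univ G" for x y z
      using countable_funs_xlang[OF L0] scott G _ that by (rule scott_sentence_embedding) simp
  qed
  show ?thesis by (rule full_value_structure_copy)
qed

theorem theorem4p10:
  fixes L0 :: "('f, 'r) lang" and lt :: 'r
    and M :: "('f, 'r, 'm) struct" and \<phi> :: "('f, 'r) fm"
    and F :: "('f, 'r, 'a) xstruct" and \<phi>\<^sub>F :: "('f xfun, 'r xrel) fm"
    and G :: "('f, 'r, 'g) xstruct"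
  assumes "countable_lang L0" and "lt \<in> rels L0" and "rel_ar L0 lt = 2"
    and "is_struct L0 M" and "countable (univ M)"
    and "strict_linear_order_on (univ M) (rel_on M lt (univ M))"
    and no_greatest: "\<forall>a\<in>univ M. \<exists>b\<in>univ M. (a, b) \<in> rel_on M lt (univ M)"
    and "scott_sentence L0 M \<phi>"
    and "has_model_of_card L0 \<phi> aleph1" and "\<not> has_model_of_card L0 \<phi> aleph2"
    and "fraisse_limit L0 lt M F" and "scott_sentence (xlang L0) F \<phi>\<^sub>F"
    and "model_of (xlang L0) \<phi>\<^sub>F G"
  shows "strict_linear_order_on (Vpart G) (tri G) \<and>
         order_char (Vpart G) (tri G) =o cofinality (Mpart G) (less_M lt G)"
proof -
  have "full_value_structure lt F"
    using assms(2,3,6,7,11) by (rule fraisse_full_value_structure)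
  from assms(1-3) this assms(12,13) interpret G: full_value_structure lt G
    by (rule scott_model_full_value_structure)
  have "Card_order (cofinality (Mpart G) (less_M lt G))" by (rule Card_order_cofinality)
  then have "order_char (Vpart G) (tri G) =o cofinality (Mpart G) (less_M lt G)"
    unfolding G.order_char_eq_cofinality by (simp add: card_order_on_well_order_on ordIso_reflexive)
  with G.V_linear show ?thesis ..
qed

end
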